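(* Consider the following family of pairs of vector fields (Kumpera-Ruiz normal forms) on $\mathbb{R}^{11}$: $$\kappa_1^{11}=\frac{\partial}{\partial x_{11}},$$ $$\kappa_2^{11}(c_{11})=(x_{11}+c_{11})\frac{\partial}{\partial x_{10}}+(x_{10}+1)\frac{\partial}{\partial x_9}+(x_9+1)\frac{\partial}{\partial x_8}+x_8\frac{\partial}{\partial x_7}+x_7\frac{\partial}{\partial x_6}+\frac{\partial}{\partial x_5}+x_6\Big(x_5\frac{\partial}{\partial x_4}+x_4\frac{\partial}{\partial x_3}+x_3\frac{\partial}{\partial x_2}+\frac{\partial}{\partial x_1}\Big),$$ where $c_{11}$ is an arbitrary real constant. The distributions spanned by two members of this family are locally equivalent at zero if and only if they have the same constant $c_{11}$, although all of them have the same singularity type $a_0a_0a_1a_2a_3a_0a_0a_0$ at zero.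
   Context: Two distributions $\mathcal{D}$, $\tilde{\mathcal{D}}$ on $\mathbb{R}^n$ are locally equivalent at zero if there is a smooth diffeomorphism $\varphi$ between two neighborhoods of zero with $\varphi(0)=0$ and $\varphi_*\mathcal{D}=\tilde{\mathcal{D}}$. The derived flag of a distribution is $\mathcal{D}^{(0)}=\mathcal{D}$, $\mathcal{D}^{(i+1)}=\mathcal{D}^{(i)}+[\mathcal{D}^{(i)},\mathcal{D}^{(i)}]$. A Goursat structure on a manifold $M$ of dimension $n\geq 3$ is a smooth rank two distribution with $\dim\mathcal{D}^{(i)}(p)=i+2$ for $0\le i\le n-2$ and every $p$; the distributions in the claim are Goursat structures. Singularity type of a Goursat structure. For $0\le i\le n-4$, $\mathcal{C}_i\subset\mathcal{D}^{(i)}$ is the unique involutive subdistribution of constant corank one in $\mathcal{D}^{(i)}$ with $[\mathcal{C}_i,\mathcal{D}^{(i+1)}]\subset\mathcal{D}^{(i+1)}$. For $0\le i\le n-5$, $S_0^{(i)}=\{q:\mathcal{D}^{(i)}(q)=\mathcal{C}_{i+1}(q)\}$; $S_0^{(i)}=\emptyset$ for $i\ge n-4$. For $1\le j\le i$, $S_j^{(i)}=\{q\in S_{j-1}^{(i)}:\mathcal{D}^{(i-j)}(q)\cap T_qS_{j-1}^{(i)}\neq\mathcal{C}_{i-j}(q)\}$; $S_j^{(i)}=\emptyset$ for $j\ge i+1$. These sets are empty or smooth submanifolds. The singularity type at $p$ is the word $\delta_{\mathcal{D}}(p)=w_{n-4}\cdots w_0$ with $w_i=a_{j+1}$ if there is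 a (necessarily unique) $j\ge0$ with $p\in S_j^{(i+j)}$, and $w_i=a_0$ otherwise. *)

theory Defs
  imports "HOL-Analysis.Analysis"
begin

section \<open>Smooth maps and distributions on Euclidean space\<close>

text \<open>Both notions below are used on open sets only.\<close>

fun Ck_on :: "nat \<Rightarrow> 'a::euclidean_space set \<Rightarrow> ('a \<Rightarrow> 'b::euclidean_space) \<Rightarrow> bool" where
  "Ck_on 0 U f \<longleftrightarrow> continuous_on U f"
| "Ck_on (Suc k) U f \<longleftrightarrow>
     (\<forall>x\<in>U. f differentiable (at x)) \<and> (\<forall>v. Ck_on k U (\<lambda>x. frechet_derivative f (at x) v))"

definition smooth_on :: "'a::euclidean_space set \<Rightarrow> ('a \<Rightarrow> 'b::euclidean_space) \<Rightarrow> bool" where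
  "smooth_on U f \<longleftrightarrow> (\<forall>k. Ck_on k U f)"

text \<open>A distribution \<open>D\<close> on the whole space assigns to each point \<open>p\<close> a subspace \<open>D p\<close> of the
  tangent space at \<open>p\<close>, which is identified with the ambient vector space.\<close>

type_synonym 'a dist = "'a \<Rightarrow> 'a set"

definition smooth_distribution :: "nat \<Rightarrow> 'a::euclidean_space dist \<Rightarrow> bool" where
  "smooth_distribution k D \<longleftrightarrow>
     (\<forall>p. dim (D p) = k) \<and>
     (\<forall>p. \<exists>U X. open U \<and> p \<in> U \<and> (\<forall>i<k. smooth_on U (X i)) \<and>
            (\<forall>q\<in>U. D q = span ((\<lambda>i::nat. X i q) ` {..<k})))"

definition section_on :: "'a::euclidean_space set \<Rightarrow> 'a dist \<Rightarrow> ('a \<Rightarrow> 'a) \<Rightarrow> bool" where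
  "section_on U D X \<longleftrightarrow> smooth_on U X \<and> (\<forall>q\<in>U. X q \<in> D q)"

definition lie_bracket :: "('a::euclidean_space \<Rightarrow> 'a) \<Rightarrow> ('a \<Rightarrow> 'a) \<Rightarrow> 'a \<Rightarrow> 'a" where
  "lie_bracket X Y p = frechet_derivative Y (at p) (X p) - frechet_derivative X (at p) (Y p)"

definition bracket_values :: "'a::euclidean_space dist \<Rightarrow> 'a dist \<Rightarrow> 'a dist" where
  "bracket_values E F p =
     {lie_bracket X Y p | X Y U. open U \<and> p \<in> U \<and> section_on U E X \<and> section_on U F Y}"

definition locally_equivalent_at_zero :: "'a::euclidean_space dist \<Rightarrow> 'a dist \<Rightarrow> bool" where
  "locally_equivalent_at_zero D D' \<longleftrightarrow>
     (\<exists>U V \<phi> \<psi>. open U \<and> 0 \<in> U \<and> open V \<and> 0 \<in> V \<and>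
        homeomorphism U V \<phi> \<psi> \<and> smooth_on U \<phi> \<and> smooth_on V \<psi> \<and> \<phi> 0 = 0 \<and>
        (\<forall>x\<in>U. frechet_derivative \<phi> (at x) ` D x = D' (\<phi> x)))"

section \<open>Goursat structures\<close>

primrec derived_flag :: "'a::euclidean_space dist \<Rightarrow> nat \<Rightarrow> 'a dist" where
  "derived_flag D 0 = D"
| "derived_flag D (Suc i) =
     (\<lambda>p. span (derived_flag D i p \<union> bracket_values (derived_flag D i) (derived_flag D i) p))"

definition goursat_structure :: "'a::euclidean_space dist \<Rightarrow> bool" where
  "goursat_structure D \<longleftrightarrow>
     3 \<le> DIM('a) \<and> smooth_distribution 2 D \<and>
     (\<forall>i\<le>DIM('a) - 2. \<forall>p. dim (derived_flag D i p) = i + 2)"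

section \<open>Singularity type\<close>

text \<open>For a Goursat structure, \<open>C\<^sub>i\<close> exists and is unique when \<open>0 \<le> i \<le> n - 4\<close>, where \<open>n\<close> is the
  dimension of the space; elsewhere \<open>char_dist\<close> is not used.  As \<open>\<D>\<^sup>(\<^sup>i\<^sup>)\<close> has rank \<open>i + 2\<close>,
  corank one means rank \<open>i + 1\<close>.\<close>

definition is_char_dist :: "'a::euclidean_space dist \<Rightarrow> nat \<Rightarrow> 'a dist \<Rightarrow> bool" where
  "is_char_dist D i C \<longleftrightarrow>
     smooth_distribution (i + 1) C \<and>
     (\<forall>p. C p \<subseteq> derived_flag D i p) \<and>
     (\<forall>p. bracket_values C C p \<subseteq> C p) \<and>
     (\<forall>p. bracket_values C (derived_flag D (i + 1)) p \<subseteq> derived_flag D (i + 1) p)"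

definition char_dist :: "'a::euclidean_space dist \<Rightarrow> nat \<Rightarrow> 'a dist" where
  "char_dist D i = (THE C. is_char_dist D i C)"

text \<open>For an embedded submanifold \<open>S\<close>, the following set is its tangent space at \<open>q\<close>.\<close>

definition tangent_space :: "'a::euclidean_space set \<Rightarrow> 'a \<Rightarrow> 'a set" where
  "tangent_space S q =
     {v. \<exists>(\<epsilon>::real) c. \<epsilon> > 0 \<and> smooth_on {-\<epsilon><..<\<epsilon>} c \<and> c ` {-\<epsilon><..<\<epsilon>} \<subseteq> S \<and>
           c 0 = q \<and> (c has_vector_derivative v) (at 0)}"

text \<open>\<open>sing_locus D i j\<close> is \<open>S\<^sub>j\<^sup>(\<^sup>i\<^sup>)\<close>.\<close>

primrec sing_locus :: "'a::euclidean_space dist \<Rightarrow> nat \<Rightarrow> nat \<Rightarrow> 'a set" where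
  "sing_locus D i 0 =
     (if i + 5 \<le> DIM('a) then {q. derived_flag D i q = char_dist D (i + 1) q} else {})"
| "sing_locus D i (Suc j) =
     (if Suc j \<le> i
      then {q \<in> sing_locus D i j.
              derived_flag D (i - Suc j) q \<inter> tangent_space (sing_locus D i j) q
                \<noteq> char_dist D (i - Suc j) q}
      else {})"

datatype letter = Letter nat  \<comment> \<open>\<open>Letter k\<close> is the letter \<open>a\<^sub>k\<close>\<close>

definition sing_letter :: "'a::euclidean_space dist \<Rightarrow> 'a \<Rightarrow> nat \<Rightarrow> letter" where
  "sing_letter D p i =
     (if \<exists>j. p \<in> sing_locus D (i + j) j
      then Letter ((THE j. p \<in> sing_locus D (i + j) j) + 1)
      else Letter 0)"

text \<open>The word \<open>w\<^sub>n\<^sub>-\<^sub>4 \<dots> w\<^sub>0\<close>, in this order.\<close>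

definition sing_type :: "'a::euclidean_space dist \<Rightarrow> 'a \<Rightarrow> letter list" where
  "sing_type D p = map (sing_letter D p) (rev [0..<DIM('a) - 3])"

section \<open>The Kumpera-Ruiz normal forms\<close>

text \<open>Coordinates are indexed by the numeral type \<open>11\<close>, in which \<open>1, \<dots>, 11\<close> are distinct
  (and \<open>11 = 0\<close>); \<open>pd i\<close> is the coordinate vector field \<open>\<partial>/\<partial>x\<^sub>i\<close>.\<close>

abbreviation pd :: "11 \<Rightarrow> real^11" where
  "pd i \<equiv> axis i 1"

definition kappa1 :: "real^11 \<Rightarrow> real^11" where
  "kappa1 x = pd 11"

definition kappa2 :: "real \<Rightarrow> real^11 \<Rightarrow> real^11" where
  "kappa2 c x =
     (x $ 11 + c) *\<^sub>R pd 10 + (x $ 10 + 1) *\<^sub>R pd 9 + (x $ 9 + 1) *\<^sub>R pd 8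
     + (x $ 8) *\<^sub>R pd 7 + (x $ 7) *\<^sub>R pd 6 + pd 5
     + (x $ 6) *\<^sub>R ((x $ 5) *\<^sub>R pd 4 + (x $ 4) *\<^sub>R pd 3 + (x $ 3) *\<^sub>R pd 2 + pd 1)"

definition KR_dist :: "real \<Rightarrow> (real^11) dist" where
  "KR_dist c x = span {kappa1 x, kappa2 c x}"

end

theory Submission
  imports Defs "HOL-Computational_Algebra.Formal_Power_Series"
begin

text \<open>
  Why all members of the family have the same singularity type. The distribution \<open>\<D>\<^sup>(\<^sup>i\<^sup>)\<close> is the
  common kernel of one-forms \<open>\<omega>\<^sub>i, \<dots>, \<omega>\<^sub>8\<close>, each of the shape
  \<open>\<omega>\<^sub>r = dx\<^sub>k - (x\<^sub>s + const) dx\<^sub>m\<close>. Here \<open>d\<omega>\<^sub>r = - dx\<^sub>s \<and> dx\<^sub>m\<close>, and \<open>\<omega>\<^sub>r\<^sub>-\<^sub>1 = 0\<close> makes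
  \<open>dx\<^sub>s\<close> and \<open>dx\<^sub>m\<close> proportional; so \<open>\<omega>\<^sub>r\<close> still vanishes on brackets of sections of
  \<open>\<D>\<^sup>(\<^sup>r\<^sup>-\<^sup>1\<^sup>)\<close>, but not on all brackets of sections of \<open>\<D>\<^sup>(\<^sup>r\<^sup>)\<close>. Every step of the derived flag
  therefore loses exactly one equation (\<open>derived_flag_KR\<close>). The same formula for brackets shows that
  \<open>\<C>\<^sub>i\<close> is spanned by the coordinate fields of index at least \<open>11 - i\<close> (\<open>char_dist_KR\<close>). The
  singular loci become coordinate subspaces: \<open>S\<^sub>0\<^sup>(\<^sup>5\<^sup>)\<close>, \<open>S\<^sub>1\<^sup>(\<^sup>5\<^sup>)\<close>, \<open>S\<^sub>2\<^sup>(\<^sup>5\<^sup>)\<close> are cut out by the successive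
  equations \<open>x\<^sub>6 = 0\<close>, \<open>x\<^sub>7 = 0\<close>, \<open>x\<^sub>8 = 0\<close>, and \<open>S\<^sub>3\<^sup>(\<^sup>5\<^sup>)\<close> requires in addition \<open>x\<^sub>9 + 1 = 0\<close>, which fails at
  the origin (\<open>zero_in_sing_locus_iff\<close>).

  Why the constant is an invariant. Let \<open>\<phi>\<close> fix the origin and carry the distribution with
  constant \<open>c\<close> to the one with constant \<open>c'\<close>. It respects the derived flags and the
  characteristic distributions (\<open>push_flag\<close>, \<open>push_vert\<close>). Differentiate along the flow of \<open>\<kappa>\<^sub>2\<close>,
  and put \<open>\<nu> = \<kappa>\<^sub>2 \<phi>\<^sub>5\<close>. Since \<open>d\<phi> \<kappa>\<^sub>2\<close> lies in the target distribution, the functions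
  \<open>\<phi>\<^sub>6, \<dots>, \<phi>\<^sub>1\<^sub>0\<close> satisfy the chain of equations \<open>\<kappa>\<^sub>2 \<phi>\<^sub>6 = \<nu> \<phi>\<^sub>7\<close>, \<dots>,
  \<open>\<kappa>\<^sub>2 \<phi>\<^sub>1\<^sub>0 = \<nu> (\<phi>\<^sub>1\<^sub>1 + c')\<close>. Invariance of \<open>\<D>\<^sup>(\<^sup>6\<^sup>)\<close>, \<open>\<C>\<^sub>6\<close> and \<open>\<C>\<^sub>7\<close> gives two more facts, in which
  \<open>f\<close>, \<open>p\<close>, \<open>q\<close> depend on \<open>x\<^sub>1, \<dots>, x\<^sub>4\<close> only: \<open>x\<^sub>6 f = \<nu> \<phi>\<^sub>6\<close> and \<open>\<phi>\<^sub>5 f = x\<^sub>5 p + q\<close>. Along \<open>\<kappa>\<^sub>2\<close> the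
  derivatives of \<open>x\<^sub>1, \<dots>, x\<^sub>4\<close> are multiples of \<open>x\<^sub>6\<close>, and on the integral curve through the
  origin \<open>x\<^sub>6 = t\<^sup>3/6 + t\<^sup>4/24 + c t\<^sup>5/120 + \<dots>\<close>, where \<open>t = x\<^sub>5\<close>. Hence \<open>f\<close>, \<open>p\<close>, \<open>q\<close> are constant
  up to order \<open>3\<close>, so \<open>\<phi>\<^sub>5 = a t\<close> up to order \<open>3\<close>. This excludes the projective reparametrisations
  of the time under which \<open>c\<close> would not be an invariant. Comparison of the coefficients of
  \<open>t\<^sup>3\<close>, \<open>t\<^sup>4\<close>, \<open>t\<^sup>5\<close> in \<open>x\<^sub>6 f = \<nu> \<phi>\<^sub>6\<close> yields \<open>f(0) = a\<^sup>4\<close>, \<open>f(0) = a\<^sup>5\<close> and \<open>c f(0) = c' a\<^sup>6\<close>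
  (\<open>taylor_rigidity\<close>). As \<open>f(0) \<noteq> 0\<close>, it follows that \<open>a = 1\<close> and \<open>c = c'\<close>.
\<close>

section \<open>Smooth functions\<close>

lemma Ck_on_cong:
  assumes "open U" "Ck_on k U f" "\<And>x. x \<in> U \<Longrightarrow> f x = g x"
  shows "Ck_on k U g"
  using assms(2,3)
proof (induction k arbitrary: f g)
  case 0
  then show ?case by (simp cong: continuous_on_cong)
next
  case (Suc k)
  have d: "f differentiable (at x)" if "x \<in> U" for x using Suc.prems that by simp
  have "g differentiable (at x)" if "x \<in> U" for x
    using d[OF that] has_derivative_transform_within_open[OF _ assms(1) that] Suc.prems(2)
    unfolding differentiable_def by metis
  moreover have "frechet_derivative f (at x) = frechet_derivative g (at x)" if "x \<in> U" for x
    using frechet_derivative_transform_within_open[OF d[OF that] assms(1) that] Suc.prems(2) by blast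
  ultimately show ?case
    using Suc.prems(1) Suc.IH[of "\<lambda>x. frechet_derivative f (at x) _"] by simp
qed

lemma Ck_on_mono:
  assumes "Ck_on (Suc k) U f"
  shows "Ck_on k U f"
  using assms
proof (induction k arbitrary: f)
  case 0
  then show ?case
    by (auto intro!: continuous_at_imp_continuous_on differentiable_imp_continuous_within)
qed simp

lemma Ck_on_const: "Ck_on k U (\<lambda>x. c)"
  by (induction k arbitrary: c) auto

lemma Ck_on_bounded_linear:
  assumes "open U" "bounded_linear L" "Ck_on k U f"
  shows "Ck_on k U (\<lambda>x. L (f x))"
  using assms(3)
proof (induction k arbitrary: f)
  case 0
  then show ?case using bounded_linear.continuous_on[OF assms(2)] by simp
next
  case (Suc k)
  have D: "((\<lambda>x. L (f x)) has_derivative (\<lambda>v. L (frechet_derivative f (at x) v))) (at x)"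
    if "x \<in> U" for x
    using Suc.prems that
    by (intro bounded_linear.has_derivative[OF assms(2)]) (auto simp flip: frechet_derivative_works)
  have "Ck_on k U (\<lambda>x. frechet_derivative (\<lambda>x. L (f x)) (at x) v)" for v
  proof (rule Ck_on_cong[OF assms(1)])
    show "Ck_on k U (\<lambda>x. L (frechet_derivative f (at x) v))"
      using Suc by simp
    show "L (frechet_derivative f (at x) v) = frechet_derivative (\<lambda>x. L (f x)) (at x) v"
      if "x \<in> U" for x
      using frechet_derivative_at[OF D[OF that]] by (rule fun_cong)
  qed
  then show ?case using D by (auto simp: differentiable_def)
qed

lemma Ck_on_add:
  assumes "open U" "Ck_on k U f" "Ck_on k U g"
  shows "Ck_on k U (\<lambda>x. f x + g x)"
  using assms(2,3)
proof (induction k arbitrary: f g)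
  case 0
  then show ?case by (simp add: continuous_on_add)
next
  case (Suc k)
  have D: "((\<lambda>x. f x + g x) has_derivative
      (\<lambda>v. frechet_derivative f (at x) v + frechet_derivative g (at x) v)) (at x)"
    if "x \<in> U" for x
    using Suc.prems that by (intro has_derivative_add) (auto simp flip: frechet_derivative_works)
  have "Ck_on k U (\<lambda>x. frechet_derivative (\<lambda>x. f x + g x) (at x) v)" for v
  proof (rule Ck_on_cong[OF assms(1)])
    show "Ck_on k U (\<lambda>x. frechet_derivative f (at x) v + frechet_derivative g (at x) v)"
      using Suc by simp
    show "frechet_derivative f (at x) v + frechet_derivative g (at x) v
        = frechet_derivative (\<lambda>x. f x + g x) (at x) v"
      if "x \<in> U" for x
      using frechet_derivative_at[OF D[OF that]] by (rule fun_cong)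
  qed
  then show ?case using D by (auto simp: differentiable_def)
qed

lemma Ck_on_bounded_bilinear:
  assumes "open U" "bounded_bilinear B" "Ck_on k U f" "Ck_on k U g"
  shows "Ck_on k U (\<lambda>x. B (f x) (g x))"
  using assms(3,4)
proof (induction k arbitrary: f g)
  case 0
  then show ?case using bounded_bilinear.continuous_on[OF assms(2)] by simp
next
  case (Suc k)
  have D: "((\<lambda>x. B (f x) (g x)) has_derivative
      (\<lambda>v. B (f x) (frechet_derivative g (at x) v) + B (frechet_derivative f (at x) v) (g x))) (at x)"
    if "x \<in> U" for x
    using Suc.prems that
    by (intro bounded_bilinear.FDERIV[OF assms(2)]) (auto simp flip: frechet_derivative_works)
  have "Ck_on k U (\<lambda>x. frechet_derivative (\<lambda>x. B (f x) (g x)) (at x) v)" for v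
  proof (rule Ck_on_cong[OF assms(1)])
    show "Ck_on k U (\<lambda>x. B (f x) (frechet_derivative g (at x) v)
        + B (frechet_derivative f (at x) v) (g x))"
      using Suc Ck_on_mono[OF Suc.prems(1)] Ck_on_mono[OF Suc.prems(2)]
      by (intro Ck_on_add[OF assms(1)] Suc.IH) auto
    show "B (f x) (frechet_derivative g (at x) v) + B (frechet_derivative f (at x) v) (g x)
        = frechet_derivative (\<lambda>x. B (f x) (g x)) (at x) v"
      if "x \<in> U" for x
      using frechet_derivative_at[OF D[OF that]] by (rule fun_cong)
  qed
  then show ?case using D by (auto simp: differentiable_def)
qed

lemma smooth_onD: "smooth_on U f \<Longrightarrow> Ck_on k U f"
  by (simp add: smooth_on_def)

lemma smooth_onI: "(\<And>k. Ck_on k U f) \<Longrightarrow> smooth_on U f"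
  by (simp add: smooth_on_def)

lemma smooth_on_cong:
  assumes "open U" "smooth_on U f" "\<And>x. x \<in> U \<Longrightarrow> f x = g x"
  shows "smooth_on U g"
  by (rule smooth_onI, rule Ck_on_cong[OF assms(1) smooth_onD[OF assms(2)] assms(3)])

lemma smooth_on_const [simp]: "smooth_on U (\<lambda>x. c)"
  by (rule smooth_onI, rule Ck_on_const)

lemma smooth_on_bounded_linear:
  assumes "open U" "bounded_linear L" "smooth_on U f"
  shows "smooth_on U (\<lambda>x. L (f x))"
  by (rule smooth_onI, rule Ck_on_bounded_linear[OF assms(1,2) smooth_onD[OF assms(3)]])

lemma smooth_on_add:
  assumes "open U" "smooth_on U f" "smooth_on U g"
  shows "smooth_on U (\<lambda>x. f x + g x)"
  by (rule smooth_onI, rule Ck_on_add[OF assms(1) smooth_onD[OF assms(2)] smooth_onD[OF assms(3)]])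

lemma smooth_on_bounded_bilinear:
  assumes "open U" "bounded_bilinear B" "smooth_on U f" "smooth_on U g"
  shows "smooth_on U (\<lambda>x. B (f x) (g x))"
  by (rule smooth_onI, rule Ck_on_bounded_bilinear[OF assms(1,2)
        smooth_onD[OF assms(3)] smooth_onD[OF assms(4)]])

lemmas smooth_on_mult = smooth_on_bounded_bilinear[OF _ bounded_bilinear_mult]
lemmas smooth_on_scaleR = smooth_on_bounded_bilinear[OF _ bounded_bilinear_scaleR]
lemmas smooth_on_vec_nth = smooth_on_bounded_linear[OF _ bounded_linear_vec_nth]

lemma smooth_on_differentiable: "smooth_on U f \<Longrightarrow> x \<in> U \<Longrightarrow> f differentiable (at x)"
  using smooth_onD[of U f "Suc 0"] by simp

lemma smooth_on_has_derivative:
  "smooth_on U f \<Longrightarrow> x \<in> U \<Longrightarrow> (f has_derivative frechet_derivative f (at x)) (at x)"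
  using smooth_on_differentiable[of U f x] by (simp flip: frechet_derivative_works)

lemma smooth_on_continuous_on: "smooth_on U f \<Longrightarrow> continuous_on U f"
  using smooth_onD[of U f 0] by simp

lemma smooth_on_directional:
  assumes "smooth_on U f"
  shows "smooth_on U (\<lambda>x. frechet_derivative f (at x) v)"
proof (rule smooth_onI)
  show "Ck_on k U (\<lambda>x. frechet_derivative f (at x) v)" for k
    using smooth_onD[OF assms, of "Suc k"] by simp
qed

lemma smooth_on_ident: "smooth_on U (\<lambda>x. x)"
proof -
  have "Ck_on k U (\<lambda>x. x)" for k
    by (cases k) (auto simp: Ck_on_const)
  then show ?thesis by (simp add: smooth_on_def)
qed

lemma smooth_on_coord: "open U \<Longrightarrow> smooth_on U (\<lambda>x::real^'n. x $ k)"
  by (rule smooth_on_vec_nth[OF _ smooth_on_ident])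

lemma smooth_on_sum:
  assumes "open U" "\<And>i. i \<in> I \<Longrightarrow> smooth_on U (f i)"
  shows "smooth_on U (\<lambda>x. \<Sum>i\<in>I. f i x)"
  using assms(2)
  by (induction I rule: infinite_finite_induct) (auto intro: smooth_on_add[OF assms(1)])

lemma frechet_derivative_expand:
  assumes "f differentiable (at x)"
  shows "frechet_derivative f (at x) v = (\<Sum>b\<in>Basis. (v \<bullet> b) *\<^sub>R frechet_derivative f (at x) b)"
proof -
  note l = linear_frechet_derivative[OF assms]
  have "frechet_derivative f (at x) v = frechet_derivative f (at x) (\<Sum>b\<in>Basis. (v \<bullet> b) *\<^sub>R b)"
    by (simp add: euclidean_representation)
  also have "\<dots> = (\<Sum>b\<in>Basis. (v \<bullet> b) *\<^sub>R frechet_derivative f (at x) b)"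
    by (simp add: linear_sum[OF l] linear_scale[OF l])
  finally show ?thesis .
qed

lemma smooth_on_derivation:
  assumes "open U" "smooth_on U f" "smooth_on U X"
  shows "smooth_on U (\<lambda>x. frechet_derivative f (at x) (X x))"
proof (rule smooth_on_cong[OF assms(1)])
  show "smooth_on U (\<lambda>x. \<Sum>b\<in>Basis. (X x \<bullet> b) *\<^sub>R frechet_derivative f (at x) b)"
    by (intro smooth_on_sum smooth_on_scaleR smooth_on_directional assms
        smooth_on_bounded_linear[OF _ bounded_linear_inner_left])
  show "(\<Sum>b\<in>Basis. (X x \<bullet> b) *\<^sub>R frechet_derivative f (at x) b)
      = frechet_derivative f (at x) (X x)" if "x \<in> U" for x
    by (rule frechet_derivative_expand[OF smooth_on_differentiable[OF assms(2) that], symmetric])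
qed

lemma frechet_derivative_component:
  assumes "f differentiable (at x)"
  shows "frechet_derivative (\<lambda>x. f x $ k) (at x) v = frechet_derivative f (at x) v $ k"
proof -
  have "((\<lambda>x. f x $ k) has_derivative (\<lambda>v. frechet_derivative f (at x) v $ k)) (at x)"
    using assms by (intro bounded_linear.has_derivative[OF bounded_linear_vec_nth])
      (simp flip: frechet_derivative_works)
  from fun_cong[OF frechet_derivative_at[OF this], of v] show ?thesis by (rule sym)
qed

text \<open>The mean value theorem, once in each direction. The second difference on the left is
  symmetric in \<open>v\<close> and \<open>w\<close>, which is why the mixed derivatives agree.\<close>
lemma second_difference:
  fixes f :: "'a::euclidean_space \<Rightarrow> real"
  assumes "smooth_on U f" "ball x r \<subseteq> U" "0 < h" "h * (norm v + norm w) < r"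
  obtains y where "dist x y \<le> h * (norm v + norm w)"
    "f (x + h *\<^sub>R v + h *\<^sub>R w) - f (x + h *\<^sub>R v) - f (x + h *\<^sub>R w) + f x
      = h\<^sup>2 * frechet_derivative (\<lambda>z. frechet_derivative f (at z) v) (at y) w"
proof -
  define df where "df z = frechet_derivative f (at z) v" for z
  have df: "smooth_on U df" unfolding df_def by (rule smooth_on_directional[OF assms(1)])
  have inU: "x + s *\<^sub>R v + t *\<^sub>R w \<in> U \<and> dist x (x + s *\<^sub>R v + t *\<^sub>R w) \<le> h * (norm v + norm w)"
    if "0 \<le> s" "s \<le> h" "0 \<le> t" "t \<le> h" for s t
  proof -
    have "norm (s *\<^sub>R v + t *\<^sub>R w) \<le> s * norm v + t * norm w"
      using norm_triangle_ineq[of "s *\<^sub>R v" "t *\<^sub>R w"] that by simp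
    also have "\<dots> \<le> h * norm v + h * norm w"
      by (intro add_mono mult_right_mono that) auto
    moreover have "dist x (x + s *\<^sub>R v + t *\<^sub>R w) = norm (s *\<^sub>R v + t *\<^sub>R w)"
      by (subst dist_commute) (simp add: dist_norm add.assoc)
    ultimately have "dist x (x + s *\<^sub>R v + t *\<^sub>R w) \<le> h * (norm v + norm w)"
      by (simp add: distrib_left)
    then show ?thesis using assms(2,4) by auto
  qed
  define F where "F s = f (x + s *\<^sub>R v + h *\<^sub>R w) - f (x + s *\<^sub>R v)" for s
  have 1: "(F has_real_derivative df (x + s *\<^sub>R v + h *\<^sub>R w) - df (x + s *\<^sub>R v)) (at s)"
    if "0 \<le> s" "s \<le> h" for s
  proof -
    have a: "((\<lambda>s. f (x + s *\<^sub>R v + h *\<^sub>R w)) has_derivative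
        (\<lambda>d. frechet_derivative f (at (x + s *\<^sub>R v + h *\<^sub>R w)) (d *\<^sub>R v))) (at s)"
      using that inU[of s h] assms(3)
      by (intro diff_chain_at[unfolded o_def, OF _ smooth_on_has_derivative[OF assms(1)]])
         (auto intro!: derivative_eq_intros)
    have b: "((\<lambda>s. f (x + s *\<^sub>R v)) has_derivative
        (\<lambda>d. frechet_derivative f (at (x + s *\<^sub>R v)) (d *\<^sub>R v))) (at s)"
      using that inU[of s 0] assms(3)
      by (intro diff_chain_at[unfolded o_def, OF _ smooth_on_has_derivative[OF assms(1)]])
         (auto intro!: derivative_eq_intros)
    have "linear (frechet_derivative f (at (x + s *\<^sub>R v + h *\<^sub>R w)))"
      "linear (frechet_derivative f (at (x + s *\<^sub>R v)))"
      using inU[of s h] inU[of s 0] that assms(3)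
      by (auto intro!: linear_frechet_derivative smooth_on_differentiable[OF assms(1)])
    note lin = this
    have "(\<lambda>d. frechet_derivative f (at (x + s *\<^sub>R v + h *\<^sub>R w)) (d *\<^sub>R v)
            - frechet_derivative f (at (x + s *\<^sub>R v)) (d *\<^sub>R v))
        = (*) (df (x + s *\<^sub>R v + h *\<^sub>R w) - df (x + s *\<^sub>R v))"
      by (simp add: fun_eq_iff df_def linear_scale[OF lin(1)] linear_scale[OF lin(2)])
        (simp add: algebra_simps)
    then show ?thesis
      using has_derivative_diff[OF a b] unfolding F_def has_field_derivative_def by simp
  qed
  obtain s where s: "0 < s" "s < h" "F h - F 0 = h * (df (x + s *\<^sub>R v + h *\<^sub>R w) - df (x + s *\<^sub>R v))"
    using MVT2[OF assms(3) 1] by auto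
  have 2: "((\<lambda>t. df (x + s *\<^sub>R v + t *\<^sub>R w)) has_real_derivative
      frechet_derivative df (at (x + s *\<^sub>R v + t *\<^sub>R w)) w) (at t)"
    if "0 \<le> t" "t \<le> h" for t
  proof -
    have "((\<lambda>t. df (x + s *\<^sub>R v + t *\<^sub>R w)) has_derivative
        (\<lambda>d. frechet_derivative df (at (x + s *\<^sub>R v + t *\<^sub>R w)) (d *\<^sub>R w))) (at t)"
      using that inU[of s t] s
      by (intro diff_chain_at[unfolded o_def, OF _ smooth_on_has_derivative[OF df]])
         (auto intro!: derivative_eq_intros)
    moreover have "linear (frechet_derivative df (at (x + s *\<^sub>R v + t *\<^sub>R w)))"
      using inU[of s t] s that
      by (auto intro!: linear_frechet_derivative smooth_on_differentiable[OF df])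
    ultimately show ?thesis
      unfolding has_field_derivative_def by (simp add: linear_scale mult_commute_abs)
  qed
  obtain t where t: "0 < t" "t < h" "df (x + s *\<^sub>R v + h *\<^sub>R w) - df (x + s *\<^sub>R v)
      = h * frechet_derivative df (at (x + s *\<^sub>R v + t *\<^sub>R w)) w"
    using MVT2[OF assms(3) 2] unfolding diff_zero scaleR_zero_left add_0_right by blast
  show thesis
  proof (rule that[of "x + s *\<^sub>R v + t *\<^sub>R w"])
    show "dist x (x + s *\<^sub>R v + t *\<^sub>R w) \<le> h * (norm v + norm w)"
      using inU[of s t] s t by simp
    show "f (x + h *\<^sub>R v + h *\<^sub>R w) - f (x + h *\<^sub>R v) - f (x + h *\<^sub>R w) + f x
      = h\<^sup>2 * frechet_derivative (\<lambda>z. frechet_derivative f (at z) v) (at (x + s *\<^sub>R v + t *\<^sub>R w)) w"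
      using s(3) t(3) unfolding F_def df_def[symmetric]
      by (simp add: power2_eq_square algebra_simps)
  qed
qed

lemma second_derivative_symmetric_real:
  fixes f :: "'a::euclidean_space \<Rightarrow> real"
  assumes "open U" "smooth_on U f" "x \<in> U"
  shows "frechet_derivative (\<lambda>z. frechet_derivative f (at z) v) (at x) w
       = frechet_derivative (\<lambda>z. frechet_derivative f (at z) w) (at x) v"
proof (rule ccontr)
  define G where "G v w z = frechet_derivative (\<lambda>z. frechet_derivative f (at z) v) (at z) w" for v w z
  assume "\<not> ?thesis"
  then have ne: "dist (G v w x) (G w v x) / 2 > 0" (is "?e > 0") by (simp add: G_def)
  have cont: "isCont (G v w) x" for v w
    using smooth_on_continuous_on[OF smooth_on_directional[OF smooth_on_directional[OF assms(2)]]]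
      assms(1,3) unfolding G_def by (simp add: continuous_on_eq_continuous_at)
  have C: "\<exists>d>0. \<forall>y. dist y x < d \<longrightarrow> dist (G p q y) (G p q x) < ?e" for p q
    using cont ne unfolding continuous_at_eps_delta by blast
  obtain d1 where d1: "d1 > 0" "\<And>y. dist y x < d1 \<Longrightarrow> dist (G v w y) (G v w x) < ?e"
    using C by blast
  obtain d2 where d2: "d2 > 0" "\<And>y. dist y x < d2 \<Longrightarrow> dist (G w v y) (G w v x) < ?e"
    using C by blast
  obtain r where r: "r > 0" "ball x r \<subseteq> U" using assms(1,3) openE by blast
  \<comment> \<open>A step so small that both intermediate points lie within the three radii; the summand \<open>1\<close>
    covers \<open>v = w = 0\<close>.\<close>
  define h where "h = min r (min d1 d2) / (2 * (norm v + norm w + 1))"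
  have den: "norm v + norm w + 1 > 0" by (simp add: add_nonneg_pos)
  have hpos: "h > 0" using r d1(1) d2(1) den by (simp add: h_def)
  have "h * (norm v + norm w) < h * (2 * (norm v + norm w + 1))"
    using hpos by (intro mult_strict_left_mono) (auto simp: add_nonneg_pos)
  also have "\<dots> = min r (min d1 d2)" using den unfolding h_def by (simp add: field_simps)
  finally have h: "h * (norm v + norm w) < r" "h * (norm v + norm w) < d1" "h * (norm v + norm w) < d2"
    by auto
  obtain y where y: "dist x y \<le> h * (norm v + norm w)"
    "f (x + h *\<^sub>R v + h *\<^sub>R w) - f (x + h *\<^sub>R v) - f (x + h *\<^sub>R w) + f x = h\<^sup>2 * G v w y"
    using second_difference[OF assms(2) r(2) hpos h(1)] unfolding G_def by blast
  obtain z where z: "dist x z \<le> h * (norm w + norm v)"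
    "f (x + h *\<^sub>R w + h *\<^sub>R v) - f (x + h *\<^sub>R w) - f (x + h *\<^sub>R v) + f x = h\<^sup>2 * G w v z"
    using second_difference[OF assms(2) r(2) hpos, of w v] h(1)
    unfolding G_def add.commute[of "norm v"] by blast
  have "h\<^sup>2 * G v w y = h\<^sup>2 * G w v z" using y(2) z(2) by (simp add: algebra_simps)
  then have eq: "G v w y = G w v z" using hpos by simp
  have "dist (G v w y) (G v w x) < ?e" "dist (G w v z) (G w v x) < ?e"
    using d1(2)[of y] d2(2)[of z] y(1) z(1) h by (auto simp: dist_commute add.commute)
  then have "dist (G v w x) (G w v x) < ?e + ?e"
    using dist_triangle2[of "G v w x" "G w v x" "G v w y"] eq by (simp add: dist_commute)
  then show False by simp
qed

lemma second_derivative_symmetric: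
  fixes f :: "'a::euclidean_space \<Rightarrow> real^'n"
  assumes "open U" "smooth_on U f" "x \<in> U"
  shows "frechet_derivative (\<lambda>z. frechet_derivative f (at z) v) (at x) w
       = frechet_derivative (\<lambda>z. frechet_derivative f (at z) w) (at x) v"
proof (subst vec_eq_iff, rule allI)
  fix k
  have c: "frechet_derivative (\<lambda>z. frechet_derivative f (at z) a) (at x) b $ k
      = frechet_derivative (\<lambda>z. frechet_derivative (\<lambda>y. f y $ k) (at z) a) (at x) b" for a b
  proof -
    note s = smooth_on_directional[OF assms(2), of a]
    have "frechet_derivative (\<lambda>z. frechet_derivative f (at z) a) (at x) b $ k
        = frechet_derivative (\<lambda>z. frechet_derivative f (at z) a $ k) (at x) b"
      using frechet_derivative_component[OF smooth_on_differentiable[OF s assms(3)]] by simp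
    also have "frechet_derivative (\<lambda>z. frechet_derivative f (at z) a $ k) (at x)
        = frechet_derivative (\<lambda>z. frechet_derivative (\<lambda>y. f y $ k) (at z) a) (at x)"
      by (rule frechet_derivative_transform_within_open[OF
            smooth_on_differentiable[OF smooth_on_vec_nth[OF assms(1) s] assms(3)] assms(1,3)])
         (simp add: frechet_derivative_component smooth_on_differentiable[OF assms(2)])
    finally show ?thesis .
  qed
  show "frechet_derivative (\<lambda>z. frechet_derivative f (at z) v) (at x) w $ k
      = frechet_derivative (\<lambda>z. frechet_derivative f (at z) w) (at x) v $ k"
    unfolding c
    by (rule second_derivative_symmetric_real[OF assms(1) smooth_on_vec_nth[OF assms(1,2)] assms(3)])
qed

section \<open>Lie brackets and push-forwards\<close>

text \<open>Product rule for \<open>x \<mapsto> df\<^sub>x(X(x))\<close>: one term differentiates \<open>df\<close> and the other one \<open>X\<close>. In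
  an orthonormal basis both factors are functions with values in fixed spaces.\<close>
lemma frechet_derivative_along_field:
  fixes f :: "'a::euclidean_space \<Rightarrow> 'b::euclidean_space"
  assumes "open U" "smooth_on U f" "smooth_on U X" "p \<in> U"
  shows "((\<lambda>x. frechet_derivative f (at x) (X x)) has_derivative
      (\<lambda>w. frechet_derivative (\<lambda>z. frechet_derivative f (at z) (X p)) (at p) w
         + frechet_derivative f (at p) (frechet_derivative X (at p) w))) (at p)"
proof -
  let ?D = "\<lambda>v x. frechet_derivative f (at x) v"
  note df = smooth_on_differentiable[OF assms(2)]
  have sum: "((\<lambda>x. \<Sum>b\<in>Basis. (X x \<bullet> b) *\<^sub>R ?D b x) has_derivative
      (\<lambda>w. \<Sum>b\<in>Basis. (X p \<bullet> b) *\<^sub>R frechet_derivative (?D b) (at p) w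
                   + (frechet_derivative X (at p) w \<bullet> b) *\<^sub>R ?D b p)) (at p)"
    using assms
    by (intro has_derivative_sum has_derivative_scaleR has_derivative_inner_left
        smooth_on_has_derivative smooth_on_directional)
  have "((\<lambda>x. \<Sum>b\<in>Basis. (X p \<bullet> b) *\<^sub>R ?D b x) has_derivative
      (\<lambda>w. \<Sum>b\<in>Basis. (X p \<bullet> b) *\<^sub>R frechet_derivative (?D b) (at p) w)) (at p)"
    using assms
    by (intro has_derivative_sum has_derivative_scaleR_right
        smooth_on_has_derivative smooth_on_directional)
  then have "(?D (X p) has_derivative
      (\<lambda>w. \<Sum>b\<in>Basis. (X p \<bullet> b) *\<^sub>R frechet_derivative (?D b) (at p) w)) (at p)"
    by (rule has_derivative_transform_within_open[OF _ assms(1,4)])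
       (rule frechet_derivative_expand[OF df, symmetric])
  from frechet_derivative_at[OF this]
  have "frechet_derivative (?D (X p)) (at p) w
      = (\<Sum>b\<in>Basis. (X p \<bullet> b) *\<^sub>R frechet_derivative (?D b) (at p) w)" for w
    by (rule fun_cong[symmetric])
  moreover have "?D (frechet_derivative X (at p) w) p
      = (\<Sum>b\<in>Basis. (frechet_derivative X (at p) w \<bullet> b) *\<^sub>R ?D b p)" for w
    by (rule frechet_derivative_expand[OF df[OF assms(4)]])
  moreover have "((\<lambda>x. ?D (X x) x) has_derivative
      (\<lambda>w. \<Sum>b\<in>Basis. (X p \<bullet> b) *\<^sub>R frechet_derivative (?D b) (at p) w
                   + (frechet_derivative X (at p) w \<bullet> b) *\<^sub>R ?D b p)) (at p)"
    by (rule has_derivative_transform_within_open[OF sum assms(1,4)])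
       (rule frechet_derivative_expand[OF df, symmetric])
  ultimately show ?thesis by (simp add: sum.distrib)
qed

text \<open>Naturality of the bracket in a form that avoids pushing vector fields forward: the
  second derivatives of \<open>\<phi>\<close> cancel by symmetry, and only values along \<open>\<phi>\<close> occur.\<close>
lemma pushforward_lie_bracket:
  fixes \<phi> :: "real^'n \<Rightarrow> real^'m"
  assumes "open U" "smooth_on U \<phi>" "smooth_on U X" "smooth_on U Y" "p \<in> U"
  shows "frechet_derivative \<phi> (at p) (lie_bracket X Y p) =
      frechet_derivative (\<lambda>x. frechet_derivative \<phi> (at x) (Y x)) (at p) (X p)
    - frechet_derivative (\<lambda>x. frechet_derivative \<phi> (at x) (X x)) (at p) (Y p)"
proof -
  have "linear (frechet_derivative \<phi> (at p))"
    by (rule linear_frechet_derivative[OF smooth_on_differentiable[OF assms(2,5)]])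
  then show ?thesis
    using frechet_derivative_at[OF frechet_derivative_along_field[OF assms(1,2,3,5)], symmetric]
      frechet_derivative_at[OF frechet_derivative_along_field[OF assms(1,2,4,5)], symmetric]
      second_derivative_symmetric[OF assms(1,2,5)]
    by (simp add: lie_bracket_def linear_diff)
qed

section \<open>Pfaffian equations\<close>

lemma UNIV_11: "UNIV = {1,2,3,4,5,6,7,8,9,10,11::11}"
proof -
  have "card {1,2,3,4,5,6,7,8,9,10,11::11} = CARD(11)" by simp
  then show ?thesis by (metis card_eq_UNIV_imp_eq_UNIV finite)
qed

lemma forall_11: "(\<forall>i::11. P i) \<longleftrightarrow>
    P 1 \<and> P 2 \<and> P 3 \<and> P 4 \<and> P 5 \<and> P 6 \<and> P 7 \<and> P 8 \<and> P 9 \<and> P 10 \<and> P 11"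
proof -
  have "(\<forall>i::11. P i) \<longleftrightarrow> (\<forall>i\<in>{1,2,3,4,5,6,7,8,9,10,11::11}. P i)"
    using UNIV_11 by blast
  then show ?thesis by simp
qed

text \<open>Equation number \<open>r\<close>, for \<open>r \<le> 8\<close>, reads \<open>dx\<^sub>k = (x\<^sub>s + e) dx\<^sub>m\<close> with \<open>k = dep r\<close>,
  \<open>s = crd r\<close>, \<open>e = shift c r\<close> and \<open>m = ind r\<close>. The equations are numbered in the order in which
  the derived flag loses them: number \<open>r\<close> holds on \<open>\<D>\<^sup>(\<^sup>i\<^sup>)\<close> exactly for \<open>i \<le> r\<close>. The list for
  \<open>crd\<close> is longer than the others, so that it enumerates all coordinates.\<close>
definition crd :: "nat \<Rightarrow> 11" where
  "crd r = [11,10,9,8,7,6,5,4,3,2,1] ! r"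

definition dep :: "nat \<Rightarrow> 11" where
  "dep r = [10,9,8,7,6,1,4,3,2] ! r"

definition ind :: "nat \<Rightarrow> 11" where
  "ind r = (if r \<le> 5 then 5 else 1)"

definition shift :: "real \<Rightarrow> nat \<Rightarrow> real" where
  "shift c r = [c,1,1,0,0,0,0,0,0] ! r"

definition pfaff :: "real \<Rightarrow> nat \<Rightarrow> real^11 \<Rightarrow> real^11 \<Rightarrow> real" where
  "pfaff c r x v = v $ dep r - (x $ crd r + shift c r) * v $ ind r"

definition flag :: "real \<Rightarrow> nat \<Rightarrow> (real^11) dist" where
  "flag c i x = {v. \<forall>r. i \<le> r \<and> r \<le> 8 \<longrightarrow> pfaff c r x v = 0}"

lemma pfaff_add: "pfaff c r x (v + w) = pfaff c r x v + pfaff c r x w"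
  and pfaff_diff: "pfaff c r x (v - w) = pfaff c r x v - pfaff c r x w"
  and pfaff_scaleR: "pfaff c r x (a *\<^sub>R v) = a * pfaff c r x v"
  by (simp_all add: pfaff_def algebra_simps)

lemma subspace_flag: "subspace (flag c i x)"
  by (auto simp: subspace_def flag_def pfaff_add pfaff_scaleR) (simp add: pfaff_def)

lemma flag_mono: "i \<le> j \<Longrightarrow> flag c i x \<subseteq> flag c j x"
  by (auto simp: flag_def)

lemma le_8_cases:
  assumes "(r::nat) \<le> 8"
  obtains "r = 0" | "r = 1" | "r = 2" | "r = 3" | "r = 4" | "r = 5" | "r = 6" | "r = 7" | "r = 8"
  using assms by fastforce

lemmas index_defs = crd_def dep_def ind_def shift_def

lemma forall_le_8: "(\<forall>r. r \<le> (8::nat) \<longrightarrow> P r) \<longleftrightarrow>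
    P 0 \<and> P 1 \<and> P 2 \<and> P 3 \<and> P 4 \<and> P 5 \<and> P 6 \<and> P 7 \<and> P 8"
  by (auto elim: le_8_cases)

text \<open>The field in the parentheses of \<open>\<kappa>\<^sub>2\<close>. It replaces \<open>\<kappa>\<^sub>2\<close> as the
  non-vertical generator from \<open>\<D>\<^sup>(\<^sup>6\<^sup>)\<close> on.\<close>
definition eta :: "real^11 \<Rightarrow> real^11" where
  "eta x = (x $ 5) *\<^sub>R pd 4 + (x $ 4) *\<^sub>R pd 3 + (x $ 3) *\<^sub>R pd 2 + pd 1"

definition slope :: "real \<Rightarrow> nat \<Rightarrow> real^11 \<Rightarrow> real^11" where
  "slope c i = (if i \<le> 5 then kappa2 c else eta)"

lemma kappa2_nth:
  "kappa2 c x $ 1 = x $ 6" "kappa2 c x $ 2 = x $ 6 * x $ 3" "kappa2 c x $ 3 = x $ 6 * x $ 4"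
  "kappa2 c x $ 4 = x $ 6 * x $ 5" "kappa2 c x $ 5 = 1" "kappa2 c x $ 6 = x $ 7"
  "kappa2 c x $ 7 = x $ 8" "kappa2 c x $ 8 = x $ 9 + 1" "kappa2 c x $ 9 = x $ 10 + 1"
  "kappa2 c x $ 10 = x $ 11 + c" "kappa2 c x $ 11 = 0"
  by (simp_all add: kappa2_def axis_def)

lemma eta_nth:
  "eta x $ 1 = 1" "eta x $ 2 = x $ 3" "eta x $ 3 = x $ 4" "eta x $ 4 = x $ 5" "eta x $ 5 = 0"
  "eta x $ 6 = 0" "eta x $ 7 = 0" "eta x $ 8 = 0" "eta x $ 9 = 0" "eta x $ 10 = 0" "eta x $ 11 = 0"
  by (simp_all add: eta_def axis_def)

lemma smooth_on_eta: "open U \<Longrightarrow> smooth_on U eta"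
  unfolding eta_def
  by (intro smooth_on_add smooth_on_scaleR smooth_on_coord smooth_on_const)

lemma smooth_on_kappa2: "open U \<Longrightarrow> smooth_on U (kappa2 c)"
  unfolding kappa2_def
  by (intro smooth_on_add smooth_on_scaleR smooth_on_coord smooth_on_const)

lemma smooth_on_slope: "open U \<Longrightarrow> smooth_on U (slope c i)"
  by (simp add: slope_def smooth_on_eta smooth_on_kappa2)

lemma pd_in_flag: "i \<le> j \<Longrightarrow> i \<le> 8 \<Longrightarrow> pd (crd i) \<in> flag c j x"
  unfolding flag_def pfaff_def mem_Collect_eq
  by (intro allI impI, elim conjE, erule le_8_cases; erule le_8_cases)
     (simp_all add: index_defs axis_def)

lemma slope_in_flag: "i \<le> 8 \<Longrightarrow> slope c i x \<in> flag c i x"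
  unfolding flag_def pfaff_def mem_Collect_eq
  by (intro allI impI, elim conjE, erule le_8_cases; erule le_8_cases)
     (simp_all add: index_defs slope_def kappa2_nth eta_nth)

lemma crd_ne_ind: "i \<le> 8 \<Longrightarrow> pd (crd i) $ ind i = 0"
  by (erule le_8_cases) (simp_all add: index_defs axis_def)

lemma slope_ind: "slope c i x $ ind i = 1"
  by (simp add: slope_def ind_def kappa2_nth eta_nth)

section \<open>Derived flag\<close>

text \<open>The identity \<open>\<omega>([X,Y]) = - d\<omega>(X,Y)\<close> for fields annihilated by \<open>\<omega>\<close>, pulled back by \<open>\<phi>\<close>. With
  \<open>\<phi>\<close> the identity map it computes derived flags; for general \<open>\<phi>\<close> it shows that \<open>\<phi>\<close>
  respects them.\<close>
lemma pfaff_pushforward_lie_bracket: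
  fixes \<phi> X Y :: "real^11 \<Rightarrow> real^11"
  assumes "open U" "smooth_on U \<phi>" "smooth_on U X" "smooth_on U Y" "p \<in> U"
    and X: "\<And>x. x \<in> U \<Longrightarrow> pfaff c r (\<phi> x) (frechet_derivative \<phi> (at x) (X x)) = 0"
    and Y: "\<And>x. x \<in> U \<Longrightarrow> pfaff c r (\<phi> x) (frechet_derivative \<phi> (at x) (Y x)) = 0"
  defines "A \<equiv> frechet_derivative \<phi> (at p) (X p)" and "B \<equiv> frechet_derivative \<phi> (at p) (Y p)"
  shows "pfaff c r (\<phi> p) (frechet_derivative \<phi> (at p) (lie_bracket X Y p))
    = A $ crd r * B $ ind r - B $ crd r * A $ ind r"
proof -
  have d: "frechet_derivative (\<lambda>x. frechet_derivative \<phi> (at x) (Z x)) (at p) w $ dep r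
      = (\<phi> p $ crd r + shift c r)
          * frechet_derivative (\<lambda>x. frechet_derivative \<phi> (at x) (Z x)) (at p) w $ ind r
        + frechet_derivative \<phi> (at p) w $ crd r * frechet_derivative \<phi> (at p) (Z p) $ ind r"
    if Z: "smooth_on U Z" "\<And>x. x \<in> U \<Longrightarrow> pfaff c r (\<phi> x) (frechet_derivative \<phi> (at x) (Z x)) = 0"
    for Z :: "real^11 \<Rightarrow> real^11" and w
  proof -
    define C where "C x = frechet_derivative \<phi> (at x) (Z x)" for x
    have C: "smooth_on U C" unfolding C_def by (rule smooth_on_derivation[OF assms(1,2) Z(1)])
    note dC = smooth_on_has_derivative[OF C assms(5)]
    note d\<phi> = smooth_on_has_derivative[OF assms(2,5)]
    have "((\<lambda>x. (\<phi> x $ crd r + shift c r) * C x $ ind r) has_derivative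
        (\<lambda>w. (\<phi> p $ crd r + shift c r) * frechet_derivative C (at p) w $ ind r
           + frechet_derivative \<phi> (at p) w $ crd r * C p $ ind r)) (at p)"
      using has_derivative_mult[OF has_derivative_add_const[OF
          bounded_linear.has_derivative[OF bounded_linear_vec_nth d\<phi>]]
          bounded_linear.has_derivative[OF bounded_linear_vec_nth dC]] .
    then have "((\<lambda>x. C x $ dep r) has_derivative
        (\<lambda>w. (\<phi> p $ crd r + shift c r) * frechet_derivative C (at p) w $ ind r
           + frechet_derivative \<phi> (at p) w $ crd r * C p $ ind r)) (at p)"
      by (rule has_derivative_transform_within_open[OF _ assms(1,5)])
         (use Z(2) in \<open>simp add: pfaff_def C_def\<close>)
    from has_derivative_unique[OF bounded_linear.has_derivative[OF bounded_linear_vec_nth dC] this]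
    show ?thesis unfolding C_def by (rule fun_cong)
  qed
  show ?thesis
    unfolding pushforward_lie_bracket[OF assms(1-5)] pfaff_def A_def B_def
    using d[OF assms(3) X, of "Y p"] d[OF assms(4) Y, of "X p"] by (simp add: algebra_simps)
qed

lemma pfaff_lie_bracket:
  assumes "open U" "smooth_on U X" "smooth_on U Y" "p \<in> U"
    and "\<And>x. x \<in> U \<Longrightarrow> pfaff c r x (X x) = 0" "\<And>x. x \<in> U \<Longrightarrow> pfaff c r x (Y x) = 0"
  shows "pfaff c r p (lie_bracket X Y p) = X p $ crd r * Y p $ ind r - Y p $ crd r * X p $ ind r"
  using pfaff_pushforward_lie_bracket[OF assms(1) smooth_on_ident assms(2-4), of c r] assms(5,6)
  by simp

text \<open>Equation \<open>r - 1\<close> expresses the coordinate \<open>crd r\<close> as a multiple of the coordinate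
  \<open>ind r\<close>, with the same factor for both vectors. For \<open>r = 6\<close> the roles are exchanged: the
  equation is \<open>dx\<^sub>1 = x\<^sub>6 dx\<^sub>5\<close>, where \<open>crd 6 = 5\<close> and \<open>ind 6 = 1\<close>.\<close>
lemma flag_curvature_vanishes:
  assumes "v \<in> flag c i x" "w \<in> flag c i x" "i < r" "r \<le> 8"
  shows "v $ crd r * w $ ind r - w $ crd r * v $ ind r = 0"
proof -
  obtain q where q: "r = Suc q" using assms(3) by (cases r) auto
  have "i \<le> q \<and> q \<le> 8" using assms(3,4) q by simp
  then have "pfaff c q x v = 0" "pfaff c q x w = 0" using assms(1,2) by (auto simp: flag_def)
  moreover from assms(4) q have "q = 0 \<or> q = 1 \<or> q = 2 \<or> q = 3 \<or> q = 4 \<or> q = 5 \<or> q = 6 \<or> q = 7"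
    by arith
  ultimately show ?thesis using q
    by (elim disjE) (simp_all add: pfaff_def index_defs)
qed

lemma flag_push_bracket:
  fixes \<phi> X Y :: "real^11 \<Rightarrow> real^11"
  assumes "open U" "smooth_on U \<phi>" "smooth_on U X" "smooth_on U Y" "p \<in> U"
    and X: "\<And>x. x \<in> U \<Longrightarrow> frechet_derivative \<phi> (at x) (X x) \<in> flag c i (\<phi> x)"
    and Y: "\<And>x. x \<in> U \<Longrightarrow> frechet_derivative \<phi> (at x) (Y x) \<in> flag c i (\<phi> x)"
  shows "frechet_derivative \<phi> (at p) (lie_bracket X Y p) \<in> flag c (Suc i) (\<phi> p)"
  unfolding flag_def mem_Collect_eq
proof (intro allI impI)
  fix r assume r: "Suc i \<le> r \<and> r \<le> 8"
  have "pfaff c r (\<phi> x) (frechet_derivative \<phi> (at x) (X x)) = 0"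
    "pfaff c r (\<phi> x) (frechet_derivative \<phi> (at x) (Y x)) = 0" if "x \<in> U" for x
    using X[OF that] Y[OF that] r by (auto simp: flag_def)
  from pfaff_pushforward_lie_bracket[OF assms(1-5) this]
  show "pfaff c r (\<phi> p) (frechet_derivative \<phi> (at p) (lie_bracket X Y p)) = 0"
    using flag_curvature_vanishes[OF X[OF assms(5)] Y[OF assms(5)]] r by simp
qed

lemma flag_bracket:
  assumes "open U" "p \<in> U" "section_on U (flag c i) X" "section_on U (flag c i) Y"
  shows "lie_bracket X Y p \<in> flag c (Suc i) p"
  using flag_push_bracket[OF assms(1) smooth_on_ident _ _ assms(2), of X Y c i] assms(3,4)
  by (simp add: section_on_def)

text \<open>The single bracket that leads from \<open>\<D>\<^sup>(\<^sup>i\<^sup>)\<close> to \<open>\<D>\<^sup>(\<^sup>i\<^sup>+\<^sup>1\<^sup>)\<close>.\<close>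
definition step_bracket :: "real \<Rightarrow> nat \<Rightarrow> real^11 \<Rightarrow> real^11" where
  "step_bracket c i = lie_bracket (\<lambda>_. pd (crd i)) (slope c i)"

lemma section_slope: "i \<le> 8 \<Longrightarrow> open U \<Longrightarrow> section_on U (flag c i) (slope c i)"
  and section_pd: "i \<le> 8 \<Longrightarrow> section_on U (flag c i) (\<lambda>_. pd (crd i))"
  by (simp_all add: section_on_def slope_in_flag pd_in_flag smooth_on_slope)

lemma step_bracket_in_flag: "i \<le> 8 \<Longrightarrow> step_bracket c i x \<in> flag c (Suc i) x"
  unfolding step_bracket_def
  by (rule flag_bracket[OF open_UNIV UNIV_I section_pd section_slope[OF _ open_UNIV]])

lemma pfaff_step_bracket:
  assumes "i \<le> 8" shows "pfaff c i x (step_bracket c i x) = 1"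
proof -
  have "pfaff c i x (pd (crd i)) = 0" "pfaff c i x (slope c i x) = 0" for x
    using pd_in_flag[OF order_refl assms] slope_in_flag[OF assms] assms by (auto simp: flag_def)
  then show ?thesis
    using pfaff_lie_bracket[OF open_UNIV smooth_on_const smooth_on_slope[OF open_UNIV] UNIV_I]
      crd_ne_ind[OF assms] slope_ind[of c i]
    unfolding step_bracket_def by simp
qed

text \<open>The form \<open>\<omega>\<^sub>i\<close> takes the value \<open>1\<close> on the new bracket, so subtracting a multiple of that
  bracket restores equation \<open>i\<close> without violating the later ones.\<close>
lemma flag_Suc_eq_span:
  assumes "i \<le> 8"
  shows "flag c (Suc i) x = span (insert (step_bracket c i x) (flag c i x))"
proof
  show "span (insert (step_bracket c i x) (flag c i x)) \<subseteq> flag c (Suc i) x"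
    using step_bracket_in_flag[OF assms] flag_mono[of i "Suc i"]
    by (intro span_minimal subspace_flag) auto
  show "flag c (Suc i) x \<subseteq> span (insert (step_bracket c i x) (flag c i x))"
  proof
    fix v assume v: "v \<in> flag c (Suc i) x"
    define u where "u = v - pfaff c i x v *\<^sub>R step_bracket c i x"
    have "pfaff c r x u = 0" if "i \<le> r" "r \<le> 8" for r
    proof (cases "r = i")
      case True
      then show ?thesis
        by (simp add: u_def pfaff_diff pfaff_scaleR pfaff_step_bracket[OF assms])
    next
      case False
      then have "Suc i \<le> r" using that by simp
      then have "pfaff c r x v = 0" "pfaff c r x (step_bracket c i x) = 0"
        using v step_bracket_in_flag[OF assms, of c x] that(2) by (auto simp: flag_def)
      then show ?thesis by (simp add: u_def pfaff_diff pfaff_scaleR)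
    qed
    then have "u \<in> flag c i x" by (simp add: flag_def)
    moreover have "v = u + pfaff c i x v *\<^sub>R step_bracket c i x" by (simp add: u_def)
    ultimately show "v \<in> span (insert (step_bracket c i x) (flag c i x))"
      by (metis insertCI span_add span_base span_scale)
  qed
qed

lemma KR_dist_eq_flag: "KR_dist c = flag c 0"
proof
  fix x
  show "KR_dist c x = flag c 0 x"
  proof
    have "kappa1 x = pd (crd 0)" "kappa2 c x = slope c 0 x"
      by (simp_all add: kappa1_def crd_def slope_def)
    then show "KR_dist c x \<subseteq> flag c 0 x"
      unfolding KR_dist_def using pd_in_flag[of 0 0] slope_in_flag[of 0]
      by (intro span_minimal subspace_flag) auto
    show "flag c 0 x \<subseteq> KR_dist c x"
    proof
      fix v assume "v \<in> flag c 0 x"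
      then have *: "\<forall>r. r \<le> 8 \<longrightarrow> pfaff c r x v = 0" by (simp add: flag_def)
      have "v = (v $ 11) *\<^sub>R kappa1 x + (v $ 5) *\<^sub>R kappa2 c x"
        using *[unfolded forall_le_8]
        unfolding vec_eq_iff forall_11
        by (simp add: kappa2_nth kappa1_def axis_def pfaff_def index_defs)
      then show "v \<in> KR_dist c x"
        unfolding KR_dist_def by (metis insertCI span_add span_base span_scale)
    qed
  qed
qed

lemma derived_flag_KR: "i \<le> 9 \<Longrightarrow> derived_flag (KR_dist c) i = flag c i"
proof (induction i)
  case 0
  then show ?case by (simp add: KR_dist_eq_flag)
next
  case (Suc i)
  then have i: "i \<le> 8" by simp
  have IH: "derived_flag (KR_dist c) i = flag c i" using Suc by simp
  have "span (flag c i p \<union> bracket_values (flag c i) (flag c i) p) = flag c (Suc i) p" for p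
  proof
    show "span (flag c i p \<union> bracket_values (flag c i) (flag c i) p) \<subseteq> flag c (Suc i) p"
      using flag_mono[of i "Suc i"] flag_bracket
      by (intro span_minimal subspace_flag) (auto simp: bracket_values_def)
    have "step_bracket c i p \<in> bracket_values (flag c i) (flag c i) p"
      unfolding bracket_values_def step_bracket_def
      using section_slope[OF i open_UNIV] section_pd[OF i] by blast
    then show "flag c (Suc i) p \<subseteq> span (flag c i p \<union> bracket_values (flag c i) (flag c i) p)"
      unfolding flag_Suc_eq_span[OF i] by (intro span_mono) auto
  qed
  then show ?case by (auto simp: IH)
qed

lemma dim_flag_Suc: 
  assumes "i \<le> 8" shows "dim (flag c (Suc i) x) = Suc (dim (flag c i x))"
proof -
  have "step_bracket c i x \<notin> flag c i x"
    using pfaff_step_bracket[OF assms, of c x] assms by (auto simp: flag_def)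
  then show ?thesis
    unfolding flag_Suc_eq_span[OF assms] by (simp add: dim_insert span_eq_iff[THEN iffD2, OF subspace_flag])
qed

text \<open>Downward induction from \<open>\<D>\<^sup>(\<^sup>9\<^sup>)\<close>, which is the whole tangent space.\<close>
lemma dim_flag: assumes "i \<le> 9" shows "dim (flag c i x) = i + 2"
  using assms
proof (induction i rule: inc_induct)
  case base
  have "flag c 9 x = UNIV" by (auto simp: flag_def)
  then show ?case by simp
next
  case (step n)
  then show ?case using dim_flag_Suc[of n c x] by simp
qed

lemma goursat_KR: "goursat_structure (KR_dist c)"
  unfolding goursat_structure_def
proof (intro conjI allI impI)
  show "smooth_distribution 2 (KR_dist c)"
    unfolding smooth_distribution_def
  proof (intro conjI allI)
    show "dim (KR_dist c p) = 2" for p using dim_flag[of 0 c p] by (simp add: KR_dist_eq_flag)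
    fix p
    define X where "X i = (if i = 0 then kappa1 else kappa2 c)" for i :: nat
    have "smooth_on UNIV kappa1" unfolding kappa1_def by simp
    then have "smooth_on UNIV (X i)" for i by (simp add: X_def smooth_on_kappa2)
    moreover have "(\<lambda>i::nat. X i q) ` {..<2} = {kappa1 q, kappa2 c q}" for q
      by (auto simp: X_def numeral_2_eq_2 lessThan_Suc)
    ultimately show "\<exists>U X. open U \<and> p \<in> U \<and> (\<forall>i<2. smooth_on U (X i)) \<and>
            (\<forall>q\<in>U. KR_dist c q = span ((\<lambda>i::nat. X i q) ` {..<2}))"
      by (intro exI[of _ UNIV] exI[of _ X]) (auto simp: KR_dist_def)
  qed
qed (use derived_flag_KR dim_flag in auto)

section \<open>Characteristic distributions\<close>

text \<open>The constant distribution that turns out to be \<open>\<C>\<^sub>i\<close>: it is spanned by the \<open>i + 1\<close> coordinate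
  fields of largest index (\<open>vert_eq_span\<close>). The description by equations is the one that suits
  computations.\<close>
definition vert :: "nat \<Rightarrow> (real^11) set" where
  "vert i = {v. \<forall>r. i < r \<and> r \<le> 10 \<longrightarrow> v $ crd r = 0}"

lemma forall_le_10: "(\<forall>r. r \<le> (10::nat) \<longrightarrow> P r) \<longleftrightarrow>
    P 0 \<and> P 1 \<and> P 2 \<and> P 3 \<and> P 4 \<and> P 5 \<and> P 6 \<and> P 7 \<and> P 8 \<and> P 9 \<and> P 10"
proof -
  have "r \<le> 10 \<longleftrightarrow> r \<le> 8 \<or> r = 9 \<or> r = (10::nat)" for r by arith
  then have "(\<forall>r. r \<le> (10::nat) \<longrightarrow> P r) \<longleftrightarrow> (\<forall>r. r \<le> 8 \<longrightarrow> P r) \<and> P 9 \<and> P 10" by auto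
  then show ?thesis unfolding forall_le_8 by simp
qed

lemma vert_alt: "vert i = {v. \<forall>r. r \<le> 10 \<longrightarrow> i < r \<longrightarrow> v $ crd r = 0}"
  by (auto simp: vert_def)

lemma bij_betw_crd: "bij_betw crd {..10} UNIV"
proof -
  have "{..10::nat} = {0,1,2,3,4,5,6,7,8,9,10}" by (auto simp: atMost_nat_numeral)
  then have "crd ` {..10} = UNIV" unfolding UNIV_11 by (auto simp: crd_def)
  moreover have "card {..10::nat} = CARD(11)" by simp
  ultimately show ?thesis
    by (metis bij_betw_def eq_card_imp_inj_on finite_atMost)
qed

lemma crd_eq_iff: "r \<le> 10 \<Longrightarrow> r' \<le> 10 \<Longrightarrow> crd r = crd r' \<longleftrightarrow> r = r'"
  using inj_on_eq_iff[OF bij_betw_imp_inj_on[OF bij_betw_crd]] by simp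

lemma subspace_vert: "subspace (vert i)"
  by (auto simp: vert_def subspace_def)

lemma pd_in_vert: "j \<le> i \<Longrightarrow> i \<le> 10 \<Longrightarrow> pd (crd j) \<in> vert i"
  by (auto simp: vert_def axis_def crd_eq_iff)

lemma vert_eq_span:
  assumes "i \<le> 10" shows "vert i = span ((\<lambda>j. pd (crd j)) ` {..<i + 1})"
proof
  show "span ((\<lambda>j. pd (crd j)) ` {..<i + 1}) \<subseteq> vert i"
    using pd_in_vert assms by (intro span_minimal subspace_vert) auto
  show "vert i \<subseteq> span ((\<lambda>j. pd (crd j)) ` {..<i + 1})"
  proof
    fix v assume v: "v \<in> vert i"
    have "(v $ k) *\<^sub>R pd k \<in> span ((\<lambda>j. pd (crd j)) ` {..<i + 1})" for k
    proof -
      obtain r where r: "r \<le> 10" "k = crd r"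
        using bij_betw_imp_surj_on[OF bij_betw_crd] by (metis UNIV_I atMost_iff imageE)
      show ?thesis
      proof (cases "r \<le> i")
        case True
        then show ?thesis unfolding r(2) by (intro span_scale span_base) auto
      next
        case False
        then have "v $ k = 0" using v r by (auto simp: vert_def)
        then show ?thesis by (simp add: span_zero)
      qed
    qed
    then have "(\<Sum>k\<in>UNIV. (v $ k) *\<^sub>R pd k) \<in> span ((\<lambda>j. pd (crd j)) ` {..<i + 1})"
      by (intro span_sum)
    then show "v \<in> span ((\<lambda>j. pd (crd j)) ` {..<i + 1})"
      using basis_expansion[of v] by (simp add: scalar_mult_eq_scaleR)
  qed
qed

lemma dim_vert: assumes "i \<le> 10" shows "dim (vert i) = i + 1"
proof -
  let ?B = "(\<lambda>j. pd (crd j)) ` {..<i + 1}"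
  have "inj_on (\<lambda>j. pd (crd j)) {..<i + 1}"
    using assms by (auto simp: inj_on_def axis_eq_axis crd_eq_iff)
  then have "card ?B = i + 1" by (simp add: card_image)
  moreover have "independent ?B"
    by (rule independent_mono[OF independent_Basis]) (auto simp: axis_in_Basis_iff)
  ultimately show ?thesis
    unfolding vert_eq_span[OF assms] by (metis dim_span_eq_card_independent)
qed

lemma ind_eq_crd: "ind r = crd (if r \<le> 5 then 6 else 10)"
  by (simp add: ind_def crd_def)

lemma frechet_derivative_nth_zero:
  fixes X :: "'a::euclidean_space \<Rightarrow> real^'n"
  assumes "open U" "smooth_on U X" "p \<in> U" "\<And>x. x \<in> U \<Longrightarrow> X x $ k = 0"
  shows "frechet_derivative X (at p) v $ k = 0"
proof -
  have "frechet_derivative X (at p) v $ k = frechet_derivative (\<lambda>x. X x $ k) (at p) v"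
    by (rule frechet_derivative_component[OF smooth_on_differentiable[OF assms(2,3)], symmetric])
  also have "frechet_derivative (\<lambda>x. X x $ k) (at p) = frechet_derivative (\<lambda>x. 0) (at p)"
    by (rule frechet_derivative_transform_within_open[OF smooth_on_differentiable[OF
          smooth_on_vec_nth[OF assms(1,2)] assms(3)] assms(1,3,4)])
  finally show ?thesis by simp
qed

lemma vert_subset_flag: "i \<le> 8 \<Longrightarrow> vert i \<subseteq> flag c i x"
  by (subst vert_eq_span, simp, intro span_minimal subspace_flag)
     (auto intro!: pd_in_flag)

text \<open>For \<open>r > i\<close> the coordinates \<open>crd r\<close> and \<open>ind r\<close> vanish on \<open>vert i\<close>, so both terms of
  \<open>d\<omega>\<^sub>r\<close> are zero when one argument is taken from \<open>vert i\<close>.\<close>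
lemma is_char_dist_vert:
  assumes i: "i \<le> 7"
  shows "is_char_dist (KR_dist c) i (\<lambda>_. vert i)"
  unfolding is_char_dist_def
proof (intro conjI allI)
  show "smooth_distribution (i + 1) (\<lambda>_. vert i)"
    unfolding smooth_distribution_def
    using i vert_eq_span[of i] dim_vert[of i]
    by (auto intro!: exI[of _ UNIV] exI[of _ "\<lambda>j _. pd (crd j)"])
  show "vert i \<subseteq> derived_flag (KR_dist c) i p" for p
    using vert_subset_flag i by (simp add: derived_flag_KR)
  show "bracket_values (\<lambda>_. vert i) (\<lambda>_. vert i) p \<subseteq> vert i" for p
    unfolding bracket_values_def section_on_def
    by (auto simp: vert_def lie_bracket_def frechet_derivative_nth_zero)
  show "bracket_values (\<lambda>_. vert i) (derived_flag (KR_dist c) (i + 1)) p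
      \<subseteq> derived_flag (KR_dist c) (i + 1) p" for p
  proof
    fix b assume "b \<in> bracket_values (\<lambda>_. vert i) (derived_flag (KR_dist c) (i + 1)) p"
    then obtain X Y U where b: "b = lie_bracket X Y p" "open U" "p \<in> U"
      and X: "smooth_on U X" "\<And>q. q \<in> U \<Longrightarrow> X q \<in> vert i"
      and Y: "smooth_on U Y" "\<And>q. q \<in> U \<Longrightarrow> Y q \<in> flag c (Suc i) q"
      using i derived_flag_KR[of "Suc i" c]
      by (auto simp: bracket_values_def section_on_def simp del: derived_flag.simps)
    have "pfaff c r p b = 0" if r: "Suc i \<le> r" "r \<le> 8" for r
    proof -
      have "vert i \<subseteq> flag c (Suc i) q" for q
        using vert_subset_flag[of i c q] flag_mono[of i "Suc i" c q] i by auto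
      then have "pfaff c r q (X q) = 0" "pfaff c r q (Y q) = 0" if "q \<in> U" for q
        using X(2)[OF that] Y(2)[OF that] r by (auto simp: flag_def)
      from pfaff_lie_bracket[OF b(2) X(1) Y(1) b(3) this]
      have "pfaff c r p b = X p $ crd r * Y p $ ind r - Y p $ crd r * X p $ ind r"
        by (simp add: b(1))
      moreover have "X p $ crd r = 0" "X p $ ind r = 0"
        using X(2)[OF b(3)] r i by (auto simp: vert_def ind_eq_crd)
      ultimately show ?thesis by simp
    qed
    then show "b \<in> derived_flag (KR_dist c) (i + 1) p"
      using i derived_flag_KR[of "Suc i" c]
      by (simp add: flag_def del: derived_flag.simps)
  qed
qed

text \<open>All the equations that are left express coordinates, directly or through one another, as
  multiples of the coordinate \<open>ind i\<close>.\<close>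
lemma flag_ind_zero_in_vert:
  assumes "i \<le> 8" "v \<in> flag c i x" "v $ ind i = 0"
  shows "v \<in> vert i"
proof -
  have "\<forall>r. r \<le> 8 \<longrightarrow> i \<le> r \<longrightarrow> pfaff c r x v = 0" using assms(2) by (simp add: flag_def)
  note rel = this[unfolded forall_le_8]
  have *: "\<forall>r. r \<le> 10 \<longrightarrow> i < r \<longrightarrow> v $ crd r = 0"
    unfolding forall_le_10 using assms(1)
    by (rule le_8_cases) (use rel assms(3) in \<open>simp_all add: pfaff_def index_defs\<close>)
  then show ?thesis by (simp add: vert_alt)
qed

lemma flag_degenerate_in_vert:
  assumes "i \<le> 7" "v \<in> flag c i x" "v $ crd (Suc i) = 0" "v $ ind (Suc i) = 0"
  shows "v \<in> vert i"
proof (rule flag_ind_zero_in_vert[OF _ assms(2)])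
  \<comment> \<open>The coordinate \<open>ind i\<close> is \<open>ind (i + 1)\<close>, except that \<open>ind 5 = crd 6\<close>.\<close>
  have "ind i = ind (Suc i) \<or> ind i = crd (Suc i)" by (cases "i = 5") (auto simp: index_defs)
  then show "v $ ind i = 0" using assms(3,4) by auto
qed (use assms(1) in simp)

text \<open>A section \<open>X\<close> of a characteristic distribution satisfies \<open>d\<omega>\<^sub>i\<^sub>+\<^sub>1(X,Y) = 0\<close> for all sections
  \<open>Y\<close> of \<open>\<D>\<^sup>(\<^sup>i\<^sup>+\<^sup>1\<^sup>)\<close>. A coordinate field and the slope field, taken as \<open>Y\<close>, make the two
  coordinates of \<open>X\<close> in this expression vanish separately.\<close>
lemma char_dist_unique:
  assumes i: "i \<le> 7" and C: "is_char_dist (KR_dist c) i C"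
  shows "C = (\<lambda>_. vert i)"
proof
  fix p
  obtain U X where U: "open U" "p \<in> U" and X: "\<And>j. j < i + 1 \<Longrightarrow> smooth_on U (X j)"
    and Ceq: "\<And>q. q \<in> U \<Longrightarrow> C q = span ((\<lambda>j::nat. X j q) ` {..<i + 1})"
    using C unfolding is_char_dist_def smooth_distribution_def by meson
  have Cflag: "C q \<subseteq> flag c i q" for q
    using C i derived_flag_KR[of i c] unfolding is_char_dist_def by simp
  have br: "bracket_values C (flag c (Suc i)) p \<subseteq> flag c (Suc i) p"
    using C i derived_flag_KR[of "Suc i" c] unfolding is_char_dist_def
    by (simp del: derived_flag.simps)
  have "X j p \<in> vert i" if j: "j < i + 1" for j
  proof -
    have XC: "X j q \<in> C q" if "q \<in> U" for q
      unfolding Ceq[OF that] using j by (intro span_base) auto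
    have secX: "section_on U C (X j)" using X[OF j] XC by (simp add: section_on_def)
    have eq: "X j p $ crd (Suc i) * Y p $ ind (Suc i) - Y p $ crd (Suc i) * X j p $ ind (Suc i) = 0"
      if Y: "section_on U (flag c (Suc i)) Y" for Y
    proof -
      have "lie_bracket (X j) Y p \<in> flag c (Suc i) p"
        using br secX Y U unfolding bracket_values_def by blast
      moreover have "pfaff c (Suc i) q (X j q) = 0" if "q \<in> U" for q
        using XC[OF that] Cflag[of q] i by (auto simp: flag_def)
      moreover have "pfaff c (Suc i) q (Y q) = 0" if "q \<in> U" for q
        using Y i that by (auto simp: flag_def section_on_def)
      ultimately show ?thesis
        using pfaff_lie_bracket[OF U(1) X[OF j] _ U(2), of Y c "Suc i"] i Y
        by (auto simp: flag_def section_on_def)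
    qed
    have "X j p $ ind (Suc i) = 0"
      using eq[OF section_pd] crd_ne_ind[of "Suc i"] i by simp
    moreover have "X j p $ crd (Suc i) = 0"
      using eq[OF section_slope[OF _ U(1)]] slope_ind[of c "Suc i"] i calculation by simp
    ultimately show ?thesis
      using flag_degenerate_in_vert[OF i] XC[OF U(2)] Cflag by blast
  qed
  then have "C p \<subseteq> vert i"
    unfolding Ceq[OF U(2)] by (intro span_minimal subspace_vert) auto
  moreover have "dim (C p) = i + 1"
    using C unfolding is_char_dist_def smooth_distribution_def by blast
  moreover have "subspace (C p)" by (simp add: Ceq[OF U(2)])
  ultimately show "C p = vert i"
    using subspace_dim_equal[OF _ subspace_vert] dim_vert[of i] i by simp
qed

lemma char_dist_KR: "i \<le> 7 \<Longrightarrow> char_dist (KR_dist c) i = (\<lambda>_. vert i)"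
  unfolding char_dist_def
  by (intro the_equality is_char_dist_vert char_dist_unique)

section \<open>Singularity type\<close>

lemma tangent_space_coordinate_subspace:
  assumes "q \<in> {x::real^'n. \<forall>j\<in>J. x $ j = 0}"
  shows "tangent_space {x. \<forall>j\<in>J. x $ j = 0} q = {v. \<forall>j\<in>J. v $ j = 0}"
proof (intro equalityI subsetI)
  fix v assume "v \<in> tangent_space {x::real^'n. \<forall>j\<in>J. x $ j = 0} q"
  then obtain \<epsilon> :: real and c where e: "\<epsilon> > 0" "c ` {-\<epsilon><..<\<epsilon>} \<subseteq> {x. \<forall>j\<in>J. x $ j = 0}"
    "(c has_vector_derivative v) (at 0)" by (auto simp: tangent_space_def)
  have "v $ j = 0" if "j \<in> J" for j
  proof -
    have "((\<lambda>t. c t $ j) has_vector_derivative v $ j) (at 0)"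
      by (rule bounded_linear.has_vector_derivative[OF bounded_linear_vec_nth e(3)])
    moreover have "((\<lambda>t. c t $ j) has_vector_derivative 0) (at 0)"
      by (rule has_vector_derivative_transform_within_open[where S = "{-\<epsilon><..<\<epsilon>}"
            and f = "\<lambda>_. 0"]) (use e that in \<open>auto simp: image_subset_iff\<close>)
    ultimately show ?thesis by (rule vector_derivative_unique_at)
  qed
  then show "v \<in> {v. \<forall>j\<in>J. v $ j = 0}" by simp
next
  fix v assume v: "v \<in> {v::real^'n. \<forall>j\<in>J. v $ j = 0}"
  have "((\<lambda>t. q + t *\<^sub>R v) has_vector_derivative v) (at 0)"
    by (auto intro!: derivative_eq_intros)
  moreover have "smooth_on {-1<..<1::real} (\<lambda>t. q + t *\<^sub>R v)"
    by (intro smooth_on_add smooth_on_scaleR smooth_on_const smooth_on_ident) auto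
  ultimately show "v \<in> tangent_space {x. \<forall>j\<in>J. x $ j = 0} q"
    using v assms unfolding tangent_space_def
    by (auto intro!: exI[of _ "1::real"] exI[of _ "\<lambda>t. q + t *\<^sub>R v"])
qed

text \<open>The slope field of \<open>\<D>\<^sup>(\<^sup>i\<^sup>)\<close> has coordinate \<open>1\<close> in the direction \<open>ind i\<close>. For \<open>i \<noteq> 5\<close> this
  direction does not belong to \<open>\<C>\<^sub>i\<^sub>+\<^sub>1\<close>; for \<open>i = 5\<close> it is \<open>\<partial>\<^sub>5\<close>, which does, and what remains is
  \<open>x\<^sub>6 \<eta>\<close>.\<close>
lemma flag_eq_vert_iff:
  assumes "i \<le> 6"
  shows "flag c i q = vert (Suc i) \<longleftrightarrow> i = 5 \<and> q $ 6 = 0"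
proof
  assume eq: "flag c i q = vert (Suc i)"
  then have "slope c i q \<in> vert (Suc i)" using slope_in_flag[of i c q] assms by simp
  then have *: "\<forall>r. r \<le> 10 \<longrightarrow> Suc i < r \<longrightarrow> slope c i q $ crd r = 0" by (simp add: vert_alt)
  have "i = 5"
    using *[THEN spec, of "if i \<le> 5 then 6 else 10"] slope_ind[of c i q] assms
    by (cases "i = 5") (auto simp: ind_eq_crd)
  then show "i = 5 \<and> q $ 6 = 0"
    using *[THEN spec, of 10] by (simp add: slope_def crd_def kappa2_nth)
next
  assume a: "i = 5 \<and> q $ 6 = 0"
  have "v \<in> flag c 5 q \<longleftrightarrow> v \<in> vert 6" for v
  proof -
    have "v \<in> flag c 5 q \<longleftrightarrow> (\<forall>r. r \<le> 8 \<longrightarrow> 5 \<le> r \<longrightarrow> pfaff c r q v = 0)"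
      by (auto simp: flag_def)
    also have "\<dots> \<longleftrightarrow> (\<forall>r. r \<le> 10 \<longrightarrow> 6 < r \<longrightarrow> v $ crd r = 0)"
      unfolding forall_le_8 forall_le_10 using a by (auto simp: pfaff_def index_defs)
    finally show ?thesis by (simp add: vert_alt)
  qed
  then show "flag c i q = vert (Suc i)" using a by (simp add: set_eq_iff)
qed

lemma sing_locus_antimono: "j \<le> j' \<Longrightarrow> sing_locus D i j' \<subseteq> sing_locus D i j"
  by (rule lift_Suc_antimono_le[of "sing_locus D i"]) auto

lemma sing_locus_0:
  "sing_locus (KR_dist c) i 0 = (if i = 5 then {q. q $ 6 = 0} else {})"
proof (cases "i \<le> 6")
  case True
  then have "derived_flag (KR_dist c) i = flag c i" "char_dist (KR_dist c) (i + 1) = (\<lambda>_. vert (Suc i))"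
    by (simp_all add: derived_flag_KR char_dist_KR)
  then show ?thesis using True flag_eq_vert_iff[OF True] by simp
qed simp

lemma sing_locus_empty: "i \<noteq> 5 \<Longrightarrow> sing_locus (KR_dist c) i j = {}"
  by (induction j) (simp_all add: sing_locus_0 del: sing_locus.simps(1))

text \<open>The step from \<open>S\<^sub>j\<close> to \<open>S\<^sub>j\<^sub>+\<^sub>1\<close>, with \<open>i = 4 - j\<close>. Modulo \<open>\<C>\<^sub>i\<close> the distribution \<open>\<D>\<^sup>(\<^sup>i\<^sup>)\<close> is spanned
  by \<open>\<kappa>\<^sub>2\<close>, so the intersection exceeds \<open>\<C>\<^sub>i\<close> exactly where \<open>\<kappa>\<^sub>2\<close> is tangent to \<open>S\<^sub>j\<close>. On \<open>S\<^sub>j\<close> only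
  one of the relevant coordinates of \<open>\<kappa>\<^sub>2\<close> can be nonzero.\<close>
lemma flag_tangent_iff:
  assumes i: "i \<in> {2, 3, 4}" and q: "\<forall>j\<in>crd ` {Suc i..5}. q $ j = 0"
  shows "flag c i q \<inter> {v. \<forall>j\<in>crd ` {Suc i..5}. v $ j = 0} = vert i \<longleftrightarrow> kappa2 c q $ crd (Suc i) \<noteq> 0"
    (is "?L \<longleftrightarrow> ?R")
proof
  assume ?L
  moreover have "kappa2 c q \<notin> vert i"
    using i by (auto simp: vert_def crd_def kappa2_nth intro!: exI[of _ 6])
  moreover have "kappa2 c q \<in> flag c i q"
    using slope_in_flag[of i c q] i by (auto simp: slope_def)
  ultimately have "\<exists>j\<in>crd ` {Suc i..5}. kappa2 c q $ j \<noteq> 0" by blast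
  then obtain r where r: "Suc i \<le> r" "r \<le> 5" "kappa2 c q $ crd r \<noteq> 0" by auto
  have "r = Suc i"
  proof (rule ccontr)
    assume "r \<noteq> Suc i"
    then have "Suc i \<le> r - 1" "r - 1 \<le> 5" using r by auto
    then have "q $ crd (r - 1) = 0" using q by auto
    moreover have "r = 4 \<or> r = 5" using r \<open>r \<noteq> Suc i\<close> i by auto
    ultimately show False using r(3) by (auto simp: crd_def kappa2_nth)
  qed
  then show ?R using r(3) by simp
next
  assume R: ?R
  show ?L
  proof (intro equalityI subsetI IntI)
    fix v assume v: "v \<in> flag c i q \<inter> {v. \<forall>j\<in>crd ` {Suc i..5}. v $ j = 0}"
    have "Suc i \<le> 5" using i by auto
    then have z: "v $ crd (Suc i) = 0" using v by auto
    moreover have "pfaff c i q v = 0" using v i by (auto simp: flag_def)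
    ultimately have "v $ 5 = 0" using R i by (auto simp: pfaff_def index_defs kappa2_nth)
    then show "v \<in> vert i"
      using flag_degenerate_in_vert[of i v c q] z v i by (auto simp: ind_def)
  next
    fix v assume "v \<in> vert i"
    then show "v \<in> flag c i q" "v \<in> {v. \<forall>j\<in>crd ` {Suc i..5}. v $ j = 0}"
      using vert_subset_flag[of i c q] i by (auto simp: vert_def)
  qed
qed

lemma sing_locus_Suc:
  assumes j: "j \<le> 2"
    and S: "sing_locus (KR_dist c) 5 j = {q. \<forall>k\<in>crd ` {5 - j..5}. q $ k = 0}"
  shows "sing_locus (KR_dist c) 5 (Suc j) =
    {q. (\<forall>k\<in>crd ` {5 - j..5}. q $ k = 0) \<and> kappa2 c q $ crd (5 - j) = 0}"
proof -
  have i: "4 - j \<in> {2, 3, 4}" "Suc (4 - j) = 5 - j" using j by auto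
  have "derived_flag (KR_dist c) (4 - j) q \<inter> tangent_space (sing_locus (KR_dist c) 5 j) q
      \<noteq> char_dist (KR_dist c) (4 - j) q \<longleftrightarrow> kappa2 c q $ crd (5 - j) = 0"
    if "\<forall>k\<in>crd ` {5 - j..5}. q $ k = 0" for q
    using flag_tangent_iff[OF i(1), of q c] that tangent_space_coordinate_subspace[of q "crd ` {5 - j..5}"]
    by (simp add: S derived_flag_KR char_dist_KR i(2))
  then show ?thesis using j S by (auto simp del: sing_locus.simps(1))
qed

text \<open>The next coordinates of \<open>\<kappa>\<^sub>2\<close> to be tested are \<open>x\<^sub>7\<close>, \<open>x\<^sub>8\<close> and \<open>x\<^sub>9 + 1\<close>. The first two define
  \<open>S\<^sub>1\<close> and \<open>S\<^sub>2\<close>; the third is \<open>1\<close> at the origin and ends the sequence.\<close>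
lemma zero_in_sing_locus_iff: "0 \<in> sing_locus (KR_dist c) i j \<longleftrightarrow> i = 5 \<and> j \<le> 2"
proof (cases "i = 5")
  case True
  have ivl: "{4..5::nat} = {4, 5}" "{3..5::nat} = {3, 4, 5}" by auto
  have S0: "sing_locus (KR_dist c) 5 0 = {q. \<forall>k\<in>crd ` {5 - 0..5}. q $ k = 0}"
    unfolding sing_locus_0 by (simp add: crd_def)
  have S1: "sing_locus (KR_dist c) 5 (Suc 0) = {q. \<forall>k\<in>crd ` {5 - Suc 0..5}. q $ k = 0}"
    by (subst sing_locus_Suc[OF _ S0]) (auto simp: ivl crd_def kappa2_nth)
  have S2: "sing_locus (KR_dist c) 5 (Suc (Suc 0)) = {q. \<forall>k\<in>crd ` {5 - Suc (Suc 0)..5}. q $ k = 0}"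
    by (subst sing_locus_Suc[OF _ S1]) (auto simp: ivl crd_def kappa2_nth)
  have S3: "0 \<notin> sing_locus (KR_dist c) 5 (Suc (Suc (Suc 0)))"
    by (subst sing_locus_Suc[OF _ S2]) (auto simp: crd_def kappa2_nth)
  have "0 \<notin> sing_locus (KR_dist c) 5 j" if "Suc (Suc (Suc 0)) \<le> j"
    using sing_locus_antimono[OF that] S3 by blast
  moreover have "j \<le> 2 \<Longrightarrow> 0 \<in> sing_locus (KR_dist c) 5 j"
    unfolding numeral_2_eq_2 le_Suc_eq using S0 S1 S2
    by (auto simp del: sing_locus.simps)
  ultimately show ?thesis using True by (cases "j \<le> 2") (auto simp del: sing_locus.simps)
next
  case False
  then show ?thesis by (simp add: sing_locus_empty)
qed

lemma sing_type_KR: "sing_type (KR_dist c) 0 =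
  [Letter 0, Letter 0, Letter 1, Letter 2, Letter 3, Letter 0, Letter 0, Letter 0]"
proof -
  have "sing_letter (KR_dist c) 0 w = (if 3 \<le> w \<and> w \<le> 5 then Letter (6 - w) else Letter 0)" for w
  proof (cases "3 \<le> w \<and> w \<le> 5")
    case True
    then have "(w + j = 5 \<and> j \<le> 2) \<longleftrightarrow> j = 5 - w" for j by auto
    moreover have "Suc (5 - w) = 6 - w" using True by arith
    ultimately show ?thesis using True by (simp add: sing_letter_def zero_in_sing_locus_iff)
  next
    case False
    then have "\<not> (w + j = 5 \<and> j \<le> 2)" for j by auto
    then show ?thesis using False by (auto simp add: sing_letter_def zero_in_sing_locus_iff)
  qed
  then show ?thesis by (simp add: sing_type_def upt_rec)
qed

section \<open>Maps that preserve the distributions\<close>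

lemma flag_decompose:
  assumes "i \<le> 8" "v \<in> flag c i x"
  shows "v - v $ ind i *\<^sub>R slope c i x \<in> vert i"
proof (rule flag_ind_zero_in_vert[OF assms(1)])
  show "v - v $ ind i *\<^sub>R slope c i x \<in> flag c i x"
    using assms slope_in_flag by (intro subspace_diff subspace_scale subspace_flag)
  show "(v - v $ ind i *\<^sub>R slope c i x) $ ind i = 0" by (simp add: slope_ind)
qed

text \<open>The vertical part of \<open>v\<close> is continued as a constant field, which is a section because
  \<open>vert i\<close> lies in \<open>\<D>\<^sup>(\<^sup>i\<^sup>)\<close> everywhere; the rest is a constant multiple of the slope field.\<close>
lemma flag_section_through:
  assumes "i \<le> 8" "v \<in> flag c i x" "open U"
  obtains Y where "section_on U (flag c i) Y" "Y x = v"
proof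
  let ?u = "v - v $ ind i *\<^sub>R slope c i x"
  have "?u \<in> flag c i y" for y
    using flag_decompose[OF assms(1,2)] vert_subset_flag[OF assms(1)] by blast
  then show "section_on U (flag c i) (\<lambda>y. ?u + v $ ind i *\<^sub>R slope c i y)"
    unfolding section_on_def
    using assms(1) slope_in_flag
    by (auto intro!: subspace_add subspace_scale subspace_flag smooth_on_add smooth_on_scaleR
        smooth_on_slope assms(3))
qed simp

text \<open>One direction of a local equivalence, with injectivity of the differential in place of the
  inverse map.\<close>
locale flag_map =
  fixes c c' :: real and U :: "(real^11) set" and \<phi> :: "real^11 \<Rightarrow> real^11"
  assumes open_U: "open U"
    and smooth: "smooth_on U \<phi>"
    and inj_D: "x \<in> U \<Longrightarrow> inj (frechet_derivative \<phi> (at x))"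
    and push_KR: "x \<in> U \<Longrightarrow> v \<in> KR_dist c x \<Longrightarrow> frechet_derivative \<phi> (at x) v \<in> KR_dist c' (\<phi> x)"
begin

abbreviation D :: "real^11 \<Rightarrow> real^11 \<Rightarrow> real^11" where
  "D x \<equiv> frechet_derivative \<phi> (at x)"

lemma linear_D: "x \<in> U \<Longrightarrow> linear (D x)"
  by (rule linear_frechet_derivative[OF smooth_on_differentiable[OF smooth]])

lemma push_flag: "i \<le> 9 \<Longrightarrow> x \<in> U \<Longrightarrow> v \<in> flag c i x \<Longrightarrow> D x v \<in> flag c' i (\<phi> x)"
proof (induction i arbitrary: x v)
  case 0
  then show ?case using push_KR by (simp add: KR_dist_eq_flag)
next
  case (Suc i)
  then have i: "i \<le> 8" by simp
  have IH: "D y w \<in> flag c' i (\<phi> y)" if "y \<in> U" "w \<in> flag c i y" for y w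
    using Suc.IH i that by simp
  have "D x (step_bracket c i x) \<in> flag c' (Suc i) (\<phi> x)"
    unfolding step_bracket_def
    using section_pd[OF i] section_slope[OF i open_U] IH
    by (intro flag_push_bracket[OF open_U smooth _ _ Suc.prems(2)]) (auto simp: section_on_def)
  moreover have "D x w \<in> flag c' (Suc i) (\<phi> x)" if "w \<in> flag c i x" for w
    using IH[OF Suc.prems(2) that] flag_mono[of i "Suc i" c'] by auto
  ultimately have "insert (step_bracket c i x) (flag c i x) \<subseteq> D x -` flag c' (Suc i) (\<phi> x)"
    by auto
  from span_minimal[OF this linear_subspace_vimage[OF linear_D[OF Suc.prems(2)] subspace_flag]]
  show ?case using Suc.prems(3) unfolding flag_Suc_eq_span[OF i, of c] by auto
qed

text \<open>The differential is injective and the two spaces have equal dimension.\<close>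
lemma push_flag_onto:
  assumes "i \<le> 9" "x \<in> U" "w \<in> flag c' i (\<phi> x)"
  obtains v where "v \<in> flag c i x" "D x v = w"
proof -
  have "D x ` flag c i x = flag c' i (\<phi> x)"
  proof (rule subspace_dim_equal)
    show "subspace (D x ` flag c i x)"
      by (rule linear_subspace_image[OF linear_D[OF assms(2)] subspace_flag])
    show "D x ` flag c i x \<subseteq> flag c' i (\<phi> x)" using push_flag[OF assms(1,2)] by auto
    have "dim (D x ` flag c i x) = dim (flag c i x)"
      using inj_D[OF assms(2)]
      by (intro dim_image_eq linear_D assms(2)) (auto intro: inj_on_subset)
    then show "dim (flag c' i (\<phi> x)) \<le> dim (D x ` flag c i x)"
      using dim_flag[OF assms(1)] by simp
  qed (rule subspace_flag)
  then show thesis using assms(3) that by (metis imageE)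
qed

text \<open>The argument for uniqueness of the characteristic distribution, transported by \<open>\<phi>\<close>: the
  vector \<open>d\<phi>(v)\<close> is in the kernel of \<open>d\<omega>\<^sub>i\<^sub>+\<^sub>1\<close> on \<open>\<D>\<^sup>(\<^sup>i\<^sup>+\<^sup>1\<^sup>)\<close>, because every vector there is the image
  of the value of a section and brackets of \<open>v\<close> with sections stay in \<open>\<D>\<^sup>(\<^sup>i\<^sup>+\<^sup>1\<^sup>)\<close>.\<close>
lemma push_vert:
  assumes "i \<le> 7" "x \<in> U" "v \<in> vert i"
  shows "D x v \<in> vert i"
proof -
  define A where "A = D x v"
  have vc: "v \<in> flag c i y" for y using vert_subset_flag[of i c y] assms by auto
  have A: "A $ crd (Suc i) * w $ ind (Suc i) - w $ crd (Suc i) * A $ ind (Suc i) = 0"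
    if w: "w \<in> flag c' (Suc i) (\<phi> x)" for w
  proof -
    obtain u where u: "u \<in> flag c (Suc i) x" "D x u = w"
      using push_flag_onto[OF _ assms(2) w] assms(1) by auto
    obtain Y where Y: "section_on U (flag c (Suc i)) Y" "Y x = u"
      using flag_section_through[OF _ u(1) open_U] assms(1) by auto
    have "section_on U (\<lambda>_. vert i) (\<lambda>_. v)" using assms(3) by (simp add: section_on_def)
    then have "lie_bracket (\<lambda>_. v) Y x \<in> bracket_values (\<lambda>_. vert i) (flag c (Suc i)) x"
      unfolding bracket_values_def using Y(1) open_U assms(2) by blast
    also have "\<dots> \<subseteq> flag c (Suc i) x"
      using is_char_dist_vert[OF assms(1), of c] derived_flag_KR[of "Suc i" c] assms(1)
      unfolding is_char_dist_def by (simp del: derived_flag.simps)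
    finally have "D x (lie_bracket (\<lambda>_. v) Y x) \<in> flag c' (Suc i) (\<phi> x)"
      using push_flag[of "Suc i"] assms(1,2) by simp
    then have 0: "pfaff c' (Suc i) (\<phi> x) (D x (lie_bracket (\<lambda>_. v) Y x)) = 0"
      using assms(1) by (simp add: flag_def)
    have "pfaff c' (Suc i) (\<phi> y) (D y v) = 0" "pfaff c' (Suc i) (\<phi> y) (D y (Y y)) = 0"
      if "y \<in> U" for y
      using push_flag[OF _ that, of "Suc i"] Y(1) vc[of y] flag_mono[of i "Suc i" c y] assms(1) that
      by (auto simp: flag_def section_on_def)
    from pfaff_pushforward_lie_bracket[OF open_U smooth smooth_on_const _ assms(2) this]
    show ?thesis using 0 Y u by (simp add: section_on_def A_def)
  qed
  have ind0: "A $ ind (Suc i) = 0"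
    using A[OF pd_in_flag[of "Suc i"]] crd_ne_ind[of "Suc i"] assms(1) by simp
  moreover have "A $ crd (Suc i) = 0"
    using A[OF slope_in_flag] slope_ind[of c' "Suc i"] assms(1) ind0 by simp
  moreover have "A \<in> flag c' i (\<phi> x)"
    using push_flag[OF _ assms(2) vc] assms(1) by (simp add: A_def)
  ultimately show ?thesis
    using flag_degenerate_in_vert[OF assms(1)] by (simp add: A_def)
qed

end

section \<open>Taylor series along a vector field\<close>

definition lie_derivative :: "('a::euclidean_space \<Rightarrow> 'a) \<Rightarrow> ('a \<Rightarrow> real) \<Rightarrow> 'a \<Rightarrow> real" where
  "lie_derivative X h x = frechet_derivative h (at x) (X x)"

text \<open>The Taylor series at time \<open>0\<close> of \<open>h\<close> along the integral curve of \<open>X\<close> through \<open>p\<close>, written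
  with iterated derivatives so that no integral curve has to be constructed. On functions that
  are smooth near \<open>p\<close> it is a ring homomorphism, and \<open>X\<close> becomes the formal derivative; this turns
  differential equations along \<open>X\<close> into equations between power series.\<close>
definition taylor :: "('a::euclidean_space \<Rightarrow> 'a) \<Rightarrow> 'a \<Rightarrow> ('a \<Rightarrow> real) \<Rightarrow> real fps" where
  "taylor X p h = Abs_fps (\<lambda>n. (lie_derivative X ^^ n) h p / fact n)"

lemma taylor_nth_0: "fps_nth (taylor X p h) 0 = h p"
  by (simp add: taylor_def)

lemma fps_deriv_taylor: "fps_deriv (taylor X p h) = taylor X p (lie_derivative X h)"
proof (rule fps_ext)
  fix n
  have "fps_nth (fps_deriv (taylor X p h)) n
      = real (Suc n) * ((lie_derivative X ^^ n) (lie_derivative X h) p / (real (Suc n) * fact n))"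
    by (simp add: taylor_def funpow_swap1 del: of_nat_Suc)
  also have "\<dots> = fps_nth (taylor X p (lie_derivative X h)) n"
    by (simp add: taylor_def del: of_nat_Suc)
  finally show "fps_nth (fps_deriv (taylor X p h)) n = fps_nth (taylor X p (lie_derivative X h)) n" .
qed

lemma taylor_nth_Suc: "fps_nth (taylor X p h) (Suc n) = fps_nth (taylor X p (lie_derivative X h)) n / of_nat (Suc n)"
  using arg_cong[OF fps_deriv_taylor[of X p h], of "\<lambda>F. fps_nth F n"] by (simp add: field_simps)

context
  fixes U :: "'a::euclidean_space set" and X :: "'a \<Rightarrow> 'a" and p :: 'a
  assumes U: "open U" and X: "smooth_on U X" and p: "p \<in> U"
begin

lemma smooth_on_lie_derivative: "smooth_on U h \<Longrightarrow> smooth_on U (lie_derivative X h)"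
  unfolding lie_derivative_def by (rule smooth_on_derivation[OF U _ X])

lemma lie_derivative_cong:
  assumes "smooth_on U h" "\<And>x. x \<in> U \<Longrightarrow> h x = g x" "x \<in> U"
  shows "lie_derivative X h x = lie_derivative X g x"
  unfolding lie_derivative_def
  using frechet_derivative_transform_within_open[OF smooth_on_differentiable[OF assms(1,3)] U assms(3,2)]
  by simp

lemma lie_derivative_add:
  assumes "smooth_on U h" "smooth_on U g" "x \<in> U"
  shows "lie_derivative X (\<lambda>x. h x + g x) x = lie_derivative X h x + lie_derivative X g x"
  unfolding lie_derivative_def
  using fun_cong[OF frechet_derivative_at[OF has_derivative_add[OF
    smooth_on_has_derivative[OF assms(1,3)] smooth_on_has_derivative[OF assms(2,3)]]], of "X x"]
  by simp

lemma lie_derivative_mult: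
  assumes "smooth_on U h" "smooth_on U g" "x \<in> U"
  shows "lie_derivative X (\<lambda>x. h x * g x) x = h x * lie_derivative X g x + lie_derivative X h x * g x"
  unfolding lie_derivative_def
  using fun_cong[OF frechet_derivative_at[OF has_derivative_mult[OF
    smooth_on_has_derivative[OF assms(1,3)] smooth_on_has_derivative[OF assms(2,3)]]], of "X x"]
  by simp

lemma taylor_cong:
  assumes "smooth_on U h" "\<And>x. x \<in> U \<Longrightarrow> h x = g x"
  shows "taylor X p h = taylor X p g"
proof (rule fps_ext)
  show "fps_nth (taylor X p h) n = fps_nth (taylor X p g) n" for n
    using assms
  proof (induction n arbitrary: h g)
    case 0
    then show ?case using p by (simp add: taylor_nth_0)
  next
    case (Suc n)
    have "fps_nth (taylor X p (lie_derivative X h)) n = fps_nth (taylor X p (lie_derivative X g)) n"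
      by (rule Suc.IH[OF smooth_on_lie_derivative[OF Suc.prems(1)]
            lie_derivative_cong[OF Suc.prems(1,2)]])
    then show ?case by (simp add: taylor_nth_Suc)
  qed
qed

lemma taylor_const: "taylor X p (\<lambda>x. a) = fps_const a"
proof -
  have "lie_derivative X (\<lambda>x. 0) = (\<lambda>x. 0)" by (simp add: lie_derivative_def fun_eq_iff)
  then have "(lie_derivative X ^^ n) (\<lambda>x. 0) = (\<lambda>x. 0)" for n by (induction n) auto
  moreover have "lie_derivative X (\<lambda>x. a) = (\<lambda>x. 0)" by (simp add: lie_derivative_def fun_eq_iff)
  ultimately have "(lie_derivative X ^^ Suc n) (\<lambda>x. a) = (\<lambda>x. 0)" for n
    by (simp only: funpow_Suc_right o_def)
  then show ?thesis
    by (intro fps_ext) (auto simp: taylor_def gr0_conv_Suc simp del: funpow.simps(2))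
qed

lemma taylor_add:
  assumes "smooth_on U h" "smooth_on U g"
  shows "taylor X p (\<lambda>x. h x + g x) = taylor X p h + taylor X p g"
proof (rule fps_ext)
  show "fps_nth (taylor X p (\<lambda>x. h x + g x)) n = fps_nth (taylor X p h + taylor X p g) n" for n
    using assms
  proof (induction n arbitrary: h g)
    case 0
    then show ?case by (simp add: taylor_nth_0)
  next
    case (Suc n)
    have "taylor X p (lie_derivative X (\<lambda>x. h x + g x))
        = taylor X p (\<lambda>x. lie_derivative X h x + lie_derivative X g x)"
      by (rule taylor_cong[OF smooth_on_lie_derivative[OF smooth_on_add[OF U Suc.prems]]])
         (rule lie_derivative_add[OF Suc.prems])
    then show ?case
      using Suc.IH[OF smooth_on_lie_derivative[OF Suc.prems(1)] smooth_on_lie_derivative[OF Suc.prems(2)]]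
      by (simp add: taylor_nth_Suc add_divide_distrib)
  qed
qed

text \<open>Induction on the coefficient: both sides satisfy the Leibniz rule and have the same constant
  term, so the binomial formula for iterated derivatives is never needed.\<close>
lemma taylor_mult:
  assumes "smooth_on U h" "smooth_on U g"
  shows "taylor X p (\<lambda>x. h x * g x) = taylor X p h * taylor X p g"
proof (rule fps_ext)
  show "fps_nth (taylor X p (\<lambda>x. h x * g x)) n = fps_nth (taylor X p h * taylor X p g) n" for n
    using assms
  proof (induction n arbitrary: h g)
    case 0
    then show ?case by (simp add: taylor_nth_0)
  next
    case (Suc n)
    note dh = smooth_on_lie_derivative[OF Suc.prems(1)]
    note dg = smooth_on_lie_derivative[OF Suc.prems(2)]
    have "taylor X p (lie_derivative X (\<lambda>x. h x * g x))
        = taylor X p (\<lambda>x. h x * lie_derivative X g x + lie_derivative X h x * g x)"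
      by (rule taylor_cong[OF smooth_on_lie_derivative[OF smooth_on_mult[OF U Suc.prems]]])
         (rule lie_derivative_mult[OF Suc.prems])
    also have "\<dots> = taylor X p (\<lambda>x. h x * lie_derivative X g x)
        + taylor X p (\<lambda>x. lie_derivative X h x * g x)"
      by (intro taylor_add smooth_on_mult U Suc.prems dh dg)
    finally have "fps_nth (taylor X p (lie_derivative X (\<lambda>x. h x * g x))) n
        = fps_nth (fps_deriv (taylor X p h * taylor X p g)) n"
      using Suc.IH[OF Suc.prems(1) dg] Suc.IH[OF dh Suc.prems(2)] by (simp add: fps_deriv_taylor)
    then show ?case by (simp add: taylor_nth_Suc del: fps_deriv_mult)
  qed
qed

end

section \<open>Invariance of the constant\<close>

text \<open>In the convolution for coefficient \<open>n\<close>, the gap in \<open>A\<close> removes the summands \<open>1\<close> and \<open>2\<close>, and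
  the low order terms missing from \<open>B\<close> remove all summands from \<open>3\<close> on.\<close>
lemma fps_mult_nth_gap:
  fixes A B :: "'a::semiring_0 fps"
  assumes "fps_nth A 1 = 0" "fps_nth A 2 = 0" "\<And>k. k + 3 \<le> n \<Longrightarrow> fps_nth B k = 0"
  shows "fps_nth (A * B) n = fps_nth A 0 * fps_nth B n"
proof -
  have "fps_nth A i * fps_nth B (n - i) = (if i = 0 then fps_nth A 0 * fps_nth B n else 0)"
    if "i \<le> n" for i
  proof -
    consider "i = 0" | "i = 1" | "i = 2" | "3 \<le> i" by linarith
    then show ?thesis using assms(1,2) assms(3)[of "n - i"] that by cases auto
  qed
  then have "fps_nth (A * B) n = (\<Sum>i=0..n. if i = 0 then fps_nth A 0 * fps_nth B n else 0)"
    unfolding fps_mult_nth by (intro sum.cong) auto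
  then show ?thesis by simp
qed

text \<open>The computation with power series in the time \<open>T\<close>. The series \<open>Gk\<close> and \<open>Hk\<close> are those of
  \<open>x\<^sub>k\<close> and \<open>\<phi>\<^sub>k\<close>, and \<open>S\<close> is that of \<open>\<phi>\<^sub>5\<close>. The chains of equations determine \<open>G6\<close> and \<open>H6\<close> up
  to order \<open>5\<close>, with \<open>c\<close> and \<open>c'\<close> in the last coefficients, provided that \<open>N\<close> has the form
  \<open>a + 0 T + 0 T\<^sup>2 + \<dots>\<close>. That is the contribution of \<open>F\<close>, \<open>P\<close>, \<open>Q\<close>: their derivatives are divisible
  by \<open>G6\<close>, hence by \<open>T\<^sup>3\<close>, so \<open>S\<close> is linear up to order \<open>3\<close>.\<close>
lemma taylor_rigidity:
  fixes T F P Q S N F' P' Q' G6 G7 G8 G9 G10 G11 H6 H7 H8 H9 H10 H11 :: "real fps"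
  assumes T: "fps_deriv T = 1" "fps_nth T 0 = 0"
    and G: "fps_deriv G6 = G7" "fps_deriv G7 = G8" "fps_deriv G8 = G9 + 1"
      "fps_deriv G9 = G10 + 1" "fps_deriv G10 = G11 + fps_const c"
    and G0: "fps_nth G6 0 = 0" "fps_nth G7 0 = 0" "fps_nth G8 0 = 0" "fps_nth G9 0 = 0"
      "fps_nth G10 0 = 0" "fps_nth G11 0 = 0"
    and F: "fps_deriv F = G6 * F'" and P: "fps_deriv P = G6 * P'" and Q: "fps_deriv Q = G6 * Q'"
    and S: "S * F = T * P + Q" "fps_deriv S = N" "fps_nth S 0 = 0"
    and GH: "G6 * F = N * H6"
    and H: "fps_deriv H6 = N * H7" "fps_deriv H7 = N * H8" "fps_deriv H8 = N * (H9 + 1)"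
      "fps_deriv H9 = N * (H10 + 1)" "fps_deriv H10 = N * (H11 + fps_const c')"
    and H0: "fps_nth H6 0 = 0" "fps_nth H7 0 = 0" "fps_nth H8 0 = 0" "fps_nth H9 0 = 0"
      "fps_nth H10 0 = 0" "fps_nth H11 0 = 0"
    and F0: "fps_nth F 0 \<noteq> 0"
  shows "c = c'"
proof -
  let ?n = "\<lambda>n F. fps_nth F n"
  note expand = fps_mult_nth sum.atLeast0_atMost_Suc numeral_eq_Suc
  have d: "fps_nth A (Suc n) = fps_nth (fps_deriv A) n / of_nat (Suc n)" for A :: "real fps" and n
    by (simp add: field_simps)
  have t: "fps_nth T 1 = 1" "fps_nth T 2 = 0" "fps_nth T 3 = 0"
    using d[of T 0] d[of T 1] d[of T 2] T by (simp_all add: numeral_eq_Suc)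
  have g10: "fps_nth G10 1 = c" using d[of G10 0] G G0 by simp
  have g9: "fps_nth G9 1 = 1" "fps_nth G9 2 = c / 2"
    using d[of G9 0] d[of G9 1] G G0 g10 by (simp_all add: numeral_eq_Suc)
  have g8: "fps_nth G8 1 = 1" "fps_nth G8 2 = 1 / 2" "fps_nth G8 3 = c / 6"
    using d[of G8 0] d[of G8 1] d[of G8 2] G G0 g9 by (simp_all add: numeral_eq_Suc)
  have g7: "fps_nth G7 1 = 0" "fps_nth G7 2 = 1 / 2" "fps_nth G7 3 = 1 / 6" "fps_nth G7 4 = c / 24"
    using d[of G7 0] d[of G7 1] d[of G7 2] d[of G7 3] G G0 g8 by (simp_all add: numeral_eq_Suc)
  have g6: "fps_nth G6 1 = 0" "fps_nth G6 2 = 0" "fps_nth G6 3 = 1 / 6" "fps_nth G6 4 = 1 / 24"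
    "fps_nth G6 5 = c / 120"
    using d[of G6 0] d[of G6 1] d[of G6 2] d[of G6 3] d[of G6 4] G G0 g7
    by (simp_all add: numeral_eq_Suc)
  \<comment> \<open>\<open>G6\<close> starts with \<open>T\<^sup>3\<close>, so a series whose derivative it divides has no terms of order \<open>1\<close> to \<open>3\<close>.\<close>
  have flat: "fps_nth A 1 = 0 \<and> fps_nth A 2 = 0 \<and> fps_nth A 3 = 0"
    if "fps_deriv A = G6 * B" for A B
    using d[of A 0] d[of A 1] d[of A 2] g6 G0 unfolding that by (simp add: expand)
  note f = flat[OF F] and p = flat[OF P] and q = flat[OF Q]
  have s: "fps_nth S 2 = 0" "fps_nth S 3 = 0"
    using arg_cong[OF S(1), of "?n 0"] arg_cong[OF S(1), of "?n 1"]
      arg_cong[OF S(1), of "?n 2"] arg_cong[OF S(1), of "?n 3"] S(3) T t f p q F0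
    by (simp_all add: expand)
  define a where "a = fps_nth N 0"
  have n: "fps_nth N 0 = a" "fps_nth N 1 = 0" "fps_nth N 2 = 0"
    using s d[of S 1] d[of S 2] S(2) by (simp_all add: a_def numeral_eq_Suc)
  have step: "fps_nth A (n + 1) = a * fps_nth B n / (n + 1)"
    if "fps_deriv A = N * B" "\<And>k. k + 3 \<le> n \<Longrightarrow> fps_nth B k = 0" for A B n
    using d[of A n] that(1) fps_mult_nth_gap[OF n(2,3) that(2)] n(1) by simp
  note pow = power_numeral_reduce
  have h10: "fps_nth H10 1 = a * c'" using step[OF H(5), of 0] H0 by simp
  have h9: "fps_nth H9 1 = a" using step[OF H(4), of 0] H0 by simp
  have h9b: "fps_nth H9 2 = a ^ 2 * c' / 2" using step[OF H(4), of 1] h10 by (simp add: pow numeral_2_eq_2)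
  have h8: "fps_nth H8 1 = a" using step[OF H(3), of 0] H0 by simp
  have h8b: "fps_nth H8 2 = a ^ 2 / 2" using step[OF H(3), of 1] h9 by (simp add: pow numeral_2_eq_2)
  have h8c: "fps_nth H8 3 = a ^ 3 * c' / 6" using step[OF H(3), of 2] h9b by (simp add: pow)
  have h7: "fps_nth H7 1 = 0" using step[OF H(2), of 0] H0 by simp
  have h7b: "fps_nth H7 2 = a ^ 2 / 2" using step[OF H(2), of 1] h8 by (simp add: pow numeral_2_eq_2)
  have h7c: "fps_nth H7 3 = a ^ 3 / 6" using step[OF H(2), of 2] h8b by (simp add: pow)
  have h7d: "fps_nth H7 4 = a ^ 4 * c' / 24" using step[OF H(2), of 3] h8c H0 by (simp add: pow)
  have H7_0: "fps_nth H7 k = 0" if "k + 3 \<le> 4" for k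
    using that H0 h7 by (cases k) auto
  have h6: "fps_nth H6 1 = 0" "fps_nth H6 2 = 0"
    using step[OF H(1), of 0] step[OF H(1), of 1] H0 h7 by (simp_all add: numeral_2_eq_2)
  have h6c: "fps_nth H6 3 = a ^ 3 / 6" using step[OF H(1), of 2] h7b by (simp add: pow)
  have h6d: "fps_nth H6 4 = a ^ 4 / 24" using step[OF H(1), of 3] h7c H0 by (simp add: pow)
  have h6e: "fps_nth H6 5 = a ^ 5 * c' / 120"
    using step[of H6 H7 4, OF H(1) H7_0] h7d by (simp add: pow)
  note h6 = h6 h6c h6d h6e
  have le_5: "k = 0 \<or> k = 1 \<or> k = 2" if "k + 3 \<le> n" "n \<le> 5" for k n :: nat
    using that by linarith
  \<comment> \<open>In \<open>G6 F = N H6\<close> only the constant terms of \<open>F\<close> and \<open>N\<close> contribute up to order \<open>5\<close>.\<close>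
  have e: "fps_nth F 0 * fps_nth G6 n = a * fps_nth H6 n" if n_le: "n \<le> 5" for n
  proof -
    have "fps_nth G6 k = 0" "fps_nth H6 k = 0" if "k + 3 \<le> n" for k
      using le_5[OF that n_le] G0 H0 g6 h6 by auto
    then have "fps_nth (F * G6) n = fps_nth F 0 * fps_nth G6 n" "fps_nth (N * H6) n = a * fps_nth H6 n"
      using fps_mult_nth_gap[of F n G6] fps_mult_nth_gap[of N n H6] f n by auto
    then show ?thesis using GH by (simp add: mult.commute)
  qed
  have e3: "fps_nth F 0 = a ^ 4" using e[of 3] g6(3) h6c by (simp add: pow)
  have e4: "fps_nth F 0 = a ^ 5" using e[of 4] g6(4) h6d by (simp add: pow)
  have e5: "fps_nth F 0 * c = a ^ 6 * c'" using e[of 5] g6(5) h6e by (simp add: pow)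
  have "a \<noteq> 0" using e3 F0 by auto
  then have "a = 1" using e3 e4 by (simp add: numeral_eq_Suc)
  then show ?thesis using e3 e5 by simp
qed

text \<open>The part of \<open>\<eta>\<close> that is independent of \<open>x\<^sub>5\<close>; its coefficients are constant along \<open>vert 6\<close>.\<close>
definition eta0 :: "real^11 \<Rightarrow> real^11" where
  "eta0 x = (x $ 4) *\<^sub>R pd 3 + (x $ 3) *\<^sub>R pd 2 + pd 1"

lemma eta_eq_eta0: "eta x = x $ 5 *\<^sub>R pd 4 + eta0 x"
  by (simp add: eta_def eta0_def)

lemma smooth_on_eta0: "open U \<Longrightarrow> smooth_on U eta0"
  unfolding eta0_def
  by (intro smooth_on_add smooth_on_scaleR smooth_on_coord smooth_on_const)

lemma frechet_derivative_eta0: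
  assumes "w \<in> vert 6" shows "frechet_derivative eta0 (at x) w = 0"
proof -
  have "(eta0 has_derivative (\<lambda>v. v $ 4 *\<^sub>R pd 3 + v $ 3 *\<^sub>R pd 2)) (at x)"
    unfolding eta0_def
    by (auto intro!: derivative_eq_intros bounded_linear.has_derivative[OF bounded_linear_vec_nth])
  from fun_cong[OF frechet_derivative_at[OF this], of w]
  have "frechet_derivative eta0 (at x) w = w $ 4 *\<^sub>R pd 3 + w $ 3 *\<^sub>R pd 2"
    by (rule sym)
  moreover have "w $ crd 7 = 0" "w $ crd 8 = 0" using assms by (auto simp: vert_def)
  ultimately show ?thesis by (simp add: crd_def)
qed

lemma kappa2_minus_eta_in_vert: "kappa2 c x - x $ 6 *\<^sub>R eta x \<in> vert 6"
  unfolding vert_alt mem_Collect_eq forall_le_10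
  by (simp add: crd_def kappa2_nth eta_nth)

text \<open>The functions \<open>f\<close>, \<open>p\<close>, \<open>q\<close> below come from \<open>d\<phi>(\<eta>) = x\<^sub>5 d\<phi>(\<partial>\<^sub>4) + d\<phi>(\<eta>\<^sub>0)\<close>: the first coordinate of
  this vector is \<open>f\<close>, since \<open>\<C>\<^sub>7\<close> is preserved, and the fourth is \<open>x\<^sub>5 p + q\<close>. The vector belongs to
  \<open>\<D>\<^sup>(\<^sup>6\<^sup>)\<close> at the image point, where the fourth coordinate is \<open>\<phi>\<^sub>5\<close> times the first. Preservation of
  \<open>\<C>\<^sub>6\<close> lets \<open>d\<phi>(\<kappa>\<^sub>2)\<close> be replaced by \<open>x\<^sub>6 d\<phi>(\<eta>)\<close> in the first coordinate, which gives
  \<open>x\<^sub>6 f = \<nu> \<phi>\<^sub>6\<close>.\<close>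
lemma flag_map_constant_eq:
  assumes "flag_map c c' U \<phi>" "0 \<in> U" "\<phi> 0 = 0"
  shows "c = c'"
proof -
  interpret flag_map c c' U \<phi> by (rule assms(1))
  define J where "J = taylor (kappa2 c) 0"
  let ?K = "lie_derivative (kappa2 c)"
  note K = smooth_on_kappa2[OF open_U, of c]
  note Jmult = taylor_mult[OF open_U K assms(2), folded J_def]
  note Jadd = taylor_add[OF open_U K assms(2), folded J_def]
  note Jcong = taylor_cong[OF open_U K assms(2), folded J_def]
  note Jconst = taylor_const[OF open_U K assms(2), folded J_def]
  note Jderiv = fps_deriv_taylor[of "kappa2 c" 0, folded J_def]
  note J0 = taylor_nth_0[of "kappa2 c" 0, folded J_def]
  note coord = smooth_on_coord[OF open_U] and phi = smooth_on_vec_nth[OF open_U smooth]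

  have Kcoord: "?K (\<lambda>x. x $ k) x = kappa2 c x $ k" for k x
    by (simp add: lie_derivative_def frechet_derivative_component)
  have Jcoord: "fps_deriv (J (\<lambda>x. x $ k)) = J (\<lambda>x. kappa2 c x $ k)" for k
  proof -
    have "?K (\<lambda>x. x $ k) = (\<lambda>x. kappa2 c x $ k)" by (rule ext) (rule Kcoord)
    then show ?thesis by (simp add: Jderiv)
  qed

  have Kphi: "?K (\<lambda>x. \<phi> x $ k) x = D x (kappa2 c x) $ k" if "x \<in> U" for k x
    using smooth_on_differentiable[OF smooth that]
    by (simp add: lie_derivative_def frechet_derivative_component)
  have smD: "smooth_on U (\<lambda>x. D x (Z x) $ k)" if "smooth_on U Z" for Z k
    by (intro smooth_on_vec_nth smooth_on_derivation open_U smooth that)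
  define \<nu> where "\<nu> x = D x (kappa2 c x) $ 5" for x
  have \<nu>: "smooth_on U \<nu>" unfolding \<nu>_def by (rule smD[OF K])
  have Dkappa: "\<forall>r. r \<le> 8 \<longrightarrow> pfaff c' r (\<phi> x) (D x (kappa2 c x)) = 0" if "x \<in> U" for x
    using push_flag[of 0, OF _ that slope_in_flag] by (simp add: slope_def flag_def)
  note Dkappa = this[unfolded forall_le_8, simplified pfaff_def index_defs, simplified, folded \<nu>_def]


  \<comment> \<open>For such \<open>Z\<close> and \<open>m\<close> the function \<open>d\<phi>(Z)\<^sub>m\<close> is constant along \<open>vert 6\<close>: the fields \<open>w\<close> in \<open>vert 6\<close>
    commute with \<open>Z\<close>, and \<open>d\<phi>(w)\<^sub>m = 0\<close>. Modulo \<open>vert 6\<close> the field \<open>\<kappa>\<^sub>2\<close> is \<open>x\<^sub>6 \<eta>\<close>.\<close>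
  have flatD: "\<exists>h'. smooth_on U h' \<and> fps_deriv (J (\<lambda>x. D x (Z x) $ m)) = J (\<lambda>x. x $ 6) * J h'"
    if Z: "smooth_on U Z" "\<And>x w. w \<in> vert 6 \<Longrightarrow> frechet_derivative Z (at x) w = 0" and m: "m \<in> {1, 4}"
    for Z m
  proof -
    define h where "h x = D x (Z x) $ m" for x
    have h: "smooth_on U h" unfolding h_def by (rule smD[OF Z(1)])
    have vert0: "D x w $ m = 0" if "x \<in> U" "w \<in> vert 6" for x w
    proof -
      have "\<forall>r. r \<le> 10 \<longrightarrow> 6 < r \<longrightarrow> D x w $ crd r = 0"
        using push_vert[OF _ that] by (simp add: vert_alt)
      then show ?thesis using m unfolding forall_le_10 by (auto simp: crd_def)
    qed
    have dh: "frechet_derivative h (at x) w = 0" if x: "x \<in> U" and w: "w \<in> vert 6" for x w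
    proof -
      have "lie_bracket (\<lambda>_. w) Z x = 0" by (simp add: lie_bracket_def Z(2)[OF w])
      then have "D x 0 = frechet_derivative (\<lambda>x. D x (Z x)) (at x) w
          - frechet_derivative (\<lambda>x. D x w) (at x) (Z x)"
        using pushforward_lie_bracket[OF open_U smooth smooth_on_const Z(1) x, of w] by simp
      moreover have "D x 0 = 0" by (rule linear_0[OF linear_D[OF x]])
      moreover have "frechet_derivative (\<lambda>x. D x w) (at x) (Z x) $ m = 0"
        using vert0[OF _ w] by (intro frechet_derivative_nth_zero[OF open_U _ x] smooth_on_directional smooth)
      moreover have "frechet_derivative h (at x) w = frechet_derivative (\<lambda>x. D x (Z x)) (at x) w $ m"
        unfolding h_def
        by (rule frechet_derivative_component[OF smooth_on_differentiable[OF
              smooth_on_derivation[OF open_U smooth Z(1)] x]])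
      ultimately show ?thesis by simp
    qed
    define h' where "h' x = frechet_derivative h (at x) (eta x)" for x
    have h': "smooth_on U h'"
      unfolding h'_def by (rule smooth_on_derivation[OF open_U h smooth_on_eta[OF open_U]])
    have Kh: "?K h x = x $ 6 * h' x" if x: "x \<in> U" for x
    proof -
      have lin: "linear (frechet_derivative h (at x))"
        by (rule linear_frechet_derivative[OF smooth_on_differentiable[OF h x]])
      have "frechet_derivative h (at x) (kappa2 c x - x $ 6 *\<^sub>R eta x) = 0"
        by (rule dh[OF x kappa2_minus_eta_in_vert])
      then show ?thesis
        by (simp add: lie_derivative_def h'_def linear_diff[OF lin] linear_scale[OF lin])
    qed
    have "fps_deriv (J h) = J (\<lambda>x. x $ 6 * h' x)"
      unfolding Jderiv
      by (rule Jcong[OF smooth_on_lie_derivative[OF open_U K assms(2) h] Kh])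
    also have "\<dots> = J (\<lambda>x. x $ 6) * J h'" by (rule Jmult[OF coord h'])
    finally show ?thesis using h' unfolding h_def by blast
  qed

  define f where "f x = D x (eta0 x) $ 1" for x
  define p where "p x = D x (pd 4) $ 4" for x
  define q where "q x = D x (eta0 x) $ 4" for x
  have sm: "smooth_on U f" "smooth_on U p" "smooth_on U q"
    unfolding f_def p_def q_def by (intro smD smooth_on_eta0[OF open_U] smooth_on_const)+
  obtain f' p' q' where FPQ: "fps_deriv (J f) = J (\<lambda>x. x $ 6) * J f'"
    "fps_deriv (J p) = J (\<lambda>x. x $ 6) * J p'" "fps_deriv (J q) = J (\<lambda>x. x $ 6) * J q'"
    using flatD[OF smooth_on_eta0[OF open_U] frechet_derivative_eta0, of 1]
      flatD[of "\<lambda>_. pd 4" 4] flatD[OF smooth_on_eta0[OF open_U] frechet_derivative_eta0, of 4]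
    unfolding f_def p_def q_def by auto

  have D_eta: "D x (eta x) = x $ 5 *\<^sub>R D x (pd 4) + D x (eta0 x)" if "x \<in> U" for x
    using linear_D[OF that] by (simp add: eta_eq_eta0 linear_add linear_scale)
  have f_eta: "D x (eta x) $ 1 = f x" if x: "x \<in> U" for x
  proof -
    have "pd (crd 7) \<in> vert 7" by (rule pd_in_vert) auto
    then have "D x (pd 4) \<in> vert 7" using push_vert[of 7 x] x by (simp add: crd_def)
    then have "D x (pd 4) $ crd 10 = 0" by (simp add: vert_def)
    then show ?thesis by (simp add: D_eta[OF x] f_def crd_def)
  qed
  have pq: "\<phi> x $ 5 * f x = x $ 5 * p x + q x" if x: "x \<in> U" for x
  proof -
    have "eta x \<in> flag c 6 x" using slope_in_flag[of 6 c x] by (simp add: slope_def)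
    then have "pfaff c' 6 (\<phi> x) (D x (eta x)) = 0"
      using push_flag[of 6 x "eta x"] x by (simp add: flag_def)
    then have "D x (eta x) $ 4 = \<phi> x $ 5 * D x (eta x) $ 1"
      by (simp add: pfaff_def index_defs)
    then show ?thesis using f_eta[OF x] by (simp add: D_eta[OF x] p_def q_def)
  qed
  have GH: "x $ 6 * f x = \<nu> x * \<phi> x $ 6" if x: "x \<in> U" for x
  proof -
    have "D x (kappa2 c x - x $ 6 *\<^sub>R eta x) \<in> vert 6"
      by (rule push_vert[OF _ x kappa2_minus_eta_in_vert]) simp
    then have "D x (kappa2 c x - x $ 6 *\<^sub>R eta x) $ crd 10 = 0" by (simp add: vert_def)
    then have "D x (kappa2 c x) $ 1 = x $ 6 * f x"
      using f_eta[OF x] linear_D[OF x] by (simp add: linear_diff linear_scale crd_def)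
    then show ?thesis using Dkappa[OF x] by (simp add: mult.commute)
  qed
  \<comment> \<open>Otherwise \<open>d\<phi>\<close> would map \<open>\<D>\<^sup>(\<^sup>6\<^sup>)\<close> at the origin to vectors with first coordinate \<open>0\<close>, although it is
    onto.\<close>
  have f0: "f 0 \<noteq> 0"
  proof -
    have "eta (\<phi> 0) \<in> flag c' 6 (\<phi> 0)" using slope_in_flag[of 6 c' "\<phi> 0"] by (simp add: slope_def)
    then obtain v where v: "v \<in> flag c 6 0" "D 0 v = eta (\<phi> 0)"
      using push_flag_onto[of 6 0 "eta (\<phi> 0)"] assms(2) by auto
    have "v - v $ 1 *\<^sub>R eta 0 \<in> vert 6"
      using flag_decompose[OF _ v(1)] by (simp add: slope_def ind_def)
    then have "D 0 (v - v $ 1 *\<^sub>R eta 0) \<in> vert 6" by (intro push_vert assms(2)) auto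
    then have "D 0 (v - v $ 1 *\<^sub>R eta 0) $ crd 10 = 0" by (simp add: vert_def)
    then have "v $ 1 * f 0 = 1"
      using f_eta[OF assms(2)] linear_D[OF assms(2)] v(2)
      by (simp add: linear_diff linear_scale crd_def eta_nth)
    then show ?thesis by auto
  qed

  have Kphi_J: "fps_deriv (J (\<lambda>x. \<phi> x $ k)) = J \<nu> * J g"
    if "smooth_on U g" "\<And>x. x \<in> U \<Longrightarrow> D x (kappa2 c x) $ k = \<nu> x * g x" for k g
    unfolding Jderiv Jmult[OF \<nu> that(1), symmetric]
    by (rule Jcong[OF smooth_on_lie_derivative[OF open_U K assms(2) phi]]) (simp add: Kphi that(2))
  have Jphi_shift: "J (\<lambda>x. \<phi> x $ k + a) = J (\<lambda>x. \<phi> x $ k) + fps_const a" for k a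
    by (simp add: Jadd[OF phi smooth_on_const] Jconst)
  have Jcoord_shift: "J (\<lambda>x. x $ k + a) = J (\<lambda>x. x $ k) + fps_const a" for k a
    by (simp add: Jadd[OF coord smooth_on_const] Jconst)
  have phi_shift: "smooth_on U (\<lambda>x. \<phi> x $ k + a)" for k a
    by (intro smooth_on_add open_U phi smooth_on_const)
  show ?thesis
  proof (rule taylor_rigidity[where T = "J (\<lambda>x. x $ 5)" and F = "J f" and P = "J p" and Q = "J q"
        and S = "J (\<lambda>x. \<phi> x $ 5)" and N = "J \<nu>" and F' = "J f'" and P' = "J p'" and Q' = "J q'"
        and ?G6.0 = "J (\<lambda>x. x $ 6)" and ?G7.0 = "J (\<lambda>x. x $ 7)" and ?G8.0 = "J (\<lambda>x. x $ 8)"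
        and ?G9.0 = "J (\<lambda>x. x $ 9)" and ?G10.0 = "J (\<lambda>x. x $ 10)" and ?G11.0 = "J (\<lambda>x. x $ 11)"
        and ?H6.0 = "J (\<lambda>x. \<phi> x $ 6)" and ?H7.0 = "J (\<lambda>x. \<phi> x $ 7)" and ?H8.0 = "J (\<lambda>x. \<phi> x $ 8)"
        and ?H9.0 = "J (\<lambda>x. \<phi> x $ 9)" and ?H10.0 = "J (\<lambda>x. \<phi> x $ 10)"
        and ?H11.0 = "J (\<lambda>x. \<phi> x $ 11)"])
    show "fps_deriv (J (\<lambda>x. x $ 5)) = 1" by (simp add: Jcoord kappa2_nth Jconst)
    show "fps_deriv (J (\<lambda>x. x $ 6)) = J (\<lambda>x. x $ 7)" "fps_deriv (J (\<lambda>x. x $ 7)) = J (\<lambda>x. x $ 8)"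
      "fps_deriv (J (\<lambda>x. x $ 8)) = J (\<lambda>x. x $ 9) + 1"
      "fps_deriv (J (\<lambda>x. x $ 9)) = J (\<lambda>x. x $ 10) + 1"
      "fps_deriv (J (\<lambda>x. x $ 10)) = J (\<lambda>x. x $ 11) + fps_const c"
      by (simp_all add: Jcoord kappa2_nth Jcoord_shift)
    show "fps_deriv (J f) = J (\<lambda>x. x $ 6) * J f'"
      "fps_deriv (J p) = J (\<lambda>x. x $ 6) * J p'" "fps_deriv (J q) = J (\<lambda>x. x $ 6) * J q'"
      by (rule FPQ)+
    have "J (\<lambda>x. \<phi> x $ 5) * J f = J (\<lambda>x. \<phi> x $ 5 * f x)" by (rule Jmult[OF phi sm(1), symmetric])
    also have "\<dots> = J (\<lambda>x. x $ 5 * p x + q x)"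
      by (rule Jcong[OF smooth_on_mult[OF open_U phi sm(1)] pq])
    also have "\<dots> = J (\<lambda>x. x $ 5) * J p + J q"
      by (simp add: Jadd[OF smooth_on_mult[OF open_U coord sm(2)] sm(3)] Jmult[OF coord sm(2)])
    finally show "J (\<lambda>x. \<phi> x $ 5) * J f = J (\<lambda>x. x $ 5) * J p + J q" .
    show "fps_deriv (J (\<lambda>x. \<phi> x $ 5)) = J \<nu>"
      using Kphi_J[OF smooth_on_const[of U 1], of 5] by (simp add: \<nu>_def Jconst)
    show "J (\<lambda>x. x $ 6) * J f = J \<nu> * J (\<lambda>x. \<phi> x $ 6)"
      unfolding Jmult[OF coord sm(1), symmetric] Jmult[OF \<nu> phi, symmetric]
      by (rule Jcong[OF smooth_on_mult[OF open_U coord sm(1)] GH])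
    show "fps_deriv (J (\<lambda>x. \<phi> x $ 6)) = J \<nu> * J (\<lambda>x. \<phi> x $ 7)"
      using Dkappa by (intro Kphi_J phi) (simp add: mult.commute)
    show "fps_deriv (J (\<lambda>x. \<phi> x $ 7)) = J \<nu> * J (\<lambda>x. \<phi> x $ 8)"
      using Dkappa by (intro Kphi_J phi) (simp add: mult.commute)
    show "fps_deriv (J (\<lambda>x. \<phi> x $ 8)) = J \<nu> * (J (\<lambda>x. \<phi> x $ 9) + 1)"
      using Kphi_J[OF phi_shift[of 9 1], of 8] Dkappa by (simp add: mult.commute Jphi_shift)
    show "fps_deriv (J (\<lambda>x. \<phi> x $ 9)) = J \<nu> * (J (\<lambda>x. \<phi> x $ 10) + 1)"
      using Kphi_J[OF phi_shift[of 10 1], of 9] Dkappa by (simp add: mult.commute Jphi_shift)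
    show "fps_deriv (J (\<lambda>x. \<phi> x $ 10)) = J \<nu> * (J (\<lambda>x. \<phi> x $ 11) + fps_const c')"
      using Kphi_J[OF phi_shift[of 11 c'], of 10] Dkappa by (simp add: mult.commute Jphi_shift)
    show "fps_nth (J f) 0 \<noteq> 0" by (simp add: J0 f0)
  qed (simp_all add: J0 assms(3))
qed

text \<open>The differential is injective because the inverse map provides a left inverse of it.\<close>
lemma locally_equivalent_imp_eq:
  assumes "locally_equivalent_at_zero (KR_dist c) (KR_dist c')"
  shows "c = c'"
proof -
  obtain U V \<phi> \<psi> where *: "open U" "0 \<in> U" "open V" "homeomorphism U V \<phi> \<psi>" "smooth_on U \<phi>"
    "smooth_on V \<psi>" "\<phi> 0 = 0"
    "\<And>x. x \<in> U \<Longrightarrow> frechet_derivative \<phi> (at x) ` KR_dist c x = KR_dist c' (\<phi> x)"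
    using assms unfolding locally_equivalent_at_zero_def by blast
  have "inj (frechet_derivative \<phi> (at x))" if x: "x \<in> U" for x
  proof -
    have V: "\<phi> x \<in> V" using *(4) x by (auto simp: homeomorphism_def)
    have "((\<lambda>z. \<psi> (\<phi> z)) has_derivative
        (\<lambda>v. frechet_derivative \<psi> (at (\<phi> x)) (frechet_derivative \<phi> (at x) v))) (at x)"
      using diff_chain_at[OF smooth_on_has_derivative[OF *(5) x] smooth_on_has_derivative[OF *(6) V]]
      by (simp add: o_def)
    then have "((\<lambda>z. z) has_derivative
        (\<lambda>v. frechet_derivative \<psi> (at (\<phi> x)) (frechet_derivative \<phi> (at x) v))) (at x)"
      by (rule has_derivative_transform_within_open[OF _ *(1) x])
         (use *(4) in \<open>auto simp: homeomorphism_def\<close>)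
    from has_derivative_unique[OF this has_derivative_ident]
    show ?thesis by (metis injI)
  qed
  then have "flag_map c c' U \<phi>"
    using * by unfold_locales auto
  then show ?thesis using flag_map_constant_eq *(2,7) by blast
qed

lemma locally_equivalent_refl: "locally_equivalent_at_zero D D"
  unfolding locally_equivalent_at_zero_def
  by (intro exI[of _ UNIV] exI[of _ "\<lambda>x. x"])
     (auto simp: smooth_on_ident homeomorphism_def)

theorem proposition7p7:
  shows "(\<forall>c c'. locally_equivalent_at_zero (KR_dist c) (KR_dist c') \<longleftrightarrow> c = c') \<and>
    (\<forall>c. goursat_structure (KR_dist c) \<and>
         sing_type (KR_dist c) 0 =
           [Letter 0, Letter 0, Letter 1, Letter 2, Letter 3, Letter 0, Letter 0, Letter 0])"
  using locally_equivalent_imp_eq locally_equivalent_refl goursat_KR sing_type_KR by blast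

end
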